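(* Let $C$ and $D$ be doubly-even binary codes of length $n$. Then $\mathcal{L}^+(C)\cong\mathcal{L}(D)$ if and only if there exists an even Kleinian code $K$ such that $C\cong\mathcal{C}(K)$ and $D\cong\mathcal{C}^+(K)$.
   Context: A binary code of length $n$ is a linear subspace of $\mathbb{F}_2^n$. The weight of a vector is its number of nonzero coordinates. A binary code is doubly-even if all its elements have weight divisible by $4$. For binary codes, $\cong$ means equivalence: one is obtained from the other by a permutation of the coordinates. Lattices from codes. Let $\alpha_1,\dots,\alpha_n$ be an orthogonal basis of $\mathbb{R}^n$ consisting of vectors of norm $(\alpha_i,\alpha_i)=2$. For $c=(c_i)\in\mathbb{F}_2^n$ put $\alpha_c=\sum_{i=1}^nc_i\alpha_i$, with $c_i$ regarded as the integers $0,1$. For a binary code $C$ of length $n$, $$\mathcal{L}(C)=\sum_{i=1}^n\mathbb{Z}\alpha_i+\sum_{c\in C}\mathbb{Z}\tfrac12\alpha_c,\qquad \mathcal{L}^+(C)=\sum_{1\le i,j\le n}\mathbb{Z}(\alpha_i+\alpha_j)+\sum_{c\in C}\mathbb{Z}\tfrac12\alpha_c .$$ For lattices in $\mathbb{R}^n$, $\cong$ means that one is obtained from the other by an orthogonal transformation of $\mathbb{R}^n$. Kleinian codes. Let $\mathbb{K}=\{0,a,b,c\}\cong\mathbb{Z}_2\times\mathbb{Z}_2$ be the Kleinian four group with identity $0$. A Kleinian code $K$ of length $m$ is a subgroup of $\mathbb{K}^m$. The weight of $x\in\mathbb{K}^m$ is its number of nonzero coordinates, and $K$ is even if all its elements have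 even weight. Binary codes from Kleinian codes. Let $\hat{\ }:\mathbb{K}^m\to\mathbb{F}_2^{4m}$ be the map induced coordinatewise from $\mathbb{K}\to\mathbb{F}_2^4$, $0\mapsto(0000)$, $a\mapsto(1100)$, $b\mapsto(1010)$, $c\mapsto(0110)$. Let $d_4^m=\{(0000),(1111)\}^m\subset\mathbb{F}_2^{4m}$ and let $(d_4^m)_0$ be the subcode of $d_4^m$ consisting of vectors of weight divisible by $8$. For a Kleinian code $K$ of length $m$, with $\hat K$ the image of $K$, define the binary codes of length $4m$ $$\mathcal{C}(K)=\hat K+d_4^m,\qquad \mathcal{C}^+(K)=\hat K+(d_4^m)_0 .$$ *)

theory Defs
  imports
    "HOL-Analysis.Analysis"
    "HOL-Library.Z2"
    "HOL-Library.Function_Algebras"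
    "HOL-Library.Set_Algebras"
    "HOL-Combinatorics.Permutations"
begin

text \<open>
  Words of length \<open>n\<close> over an alphabet with a zero are functions on \<open>nat\<close> that vanish
  at all positions \<open>\<ge> n\<close>; the coordinates are \<open>0, \<dots>, n - 1\<close>. Addition of words is pointwise
  (\<open>Function_Algebras\<close>) and \<open>+\<close> on sets of words is the elementwise sum (\<open>Set_Algebras\<close>).
\<close>

definition words :: "nat \<Rightarrow> (nat \<Rightarrow> 'a::zero) set" where
  "words n = {x. \<forall>i\<ge>n. x i = 0}"

definition weight :: "(nat \<Rightarrow> 'a::zero) \<Rightarrow> nat" where
  "weight x = card {i. x i \<noteq> 0}"

global_interpretation binary: vector_space "\<lambda>(k::bit) (x :: nat \<Rightarrow> bit) i. k * x i"
  by unfold_locales (auto simp: fun_eq_iff algebra_simps)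

definition binary_code :: "nat \<Rightarrow> (nat \<Rightarrow> bit) set \<Rightarrow> bool" where
  "binary_code n C \<longleftrightarrow> C \<subseteq> words n \<and> binary.subspace C"

definition doubly_even :: "(nat \<Rightarrow> bit) set \<Rightarrow> bool" where
  "doubly_even C \<longleftrightarrow> (\<forall>c\<in>C. 4 dvd weight c)"

definition code_equiv :: "nat \<Rightarrow> (nat \<Rightarrow> bit) set \<Rightarrow> (nat \<Rightarrow> bit) set \<Rightarrow> bool" where
  "code_equiv n C D \<longleftrightarrow> (\<exists>\<pi>. \<pi> permutes {..<n} \<and> D = (\<lambda>c. c \<circ> \<pi>) ` C)"

definition norm2_orthogonal_basis :: "(nat \<Rightarrow> real ^ 'n) \<Rightarrow> bool" where
  "norm2_orthogonal_basis \<alpha> \<longleftrightarrow>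
     (\<forall>i<CARD('n). \<alpha> i \<bullet> \<alpha> i = 2) \<and>
     (\<forall>i<CARD('n). \<forall>j<CARD('n). i \<noteq> j \<longrightarrow> orthogonal (\<alpha> i) (\<alpha> j)) \<and>
     independent (\<alpha> ` {..<CARD('n)}) \<and> span (\<alpha> ` {..<CARD('n)}) = UNIV"

global_interpretation zmod: module "\<lambda>(k::int) (v :: real ^ 'n). of_int k *\<^sub>R v"
  by unfold_locales (auto simp: algebra_simps)

definition code_vector :: "(nat \<Rightarrow> real ^ 'n) \<Rightarrow> (nat \<Rightarrow> bit) \<Rightarrow> real ^ 'n" where
  "code_vector \<alpha> c = (\<Sum>i<CARD('n). of_bool (c i = 1) *\<^sub>R \<alpha> i)"

definition code_lattice ::
    "(nat \<Rightarrow> real ^ 'n) \<Rightarrow> (nat \<Rightarrow> bit) set \<Rightarrow> (real ^ 'n) set" where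
  "code_lattice \<alpha> C =
     zmod.span {\<alpha> i | i. i < CARD('n)} +
     zmod.span {(1/2) *\<^sub>R code_vector \<alpha> c | c. c \<in> C}"

definition code_lattice_plus ::
    "(nat \<Rightarrow> real ^ 'n) \<Rightarrow> (nat \<Rightarrow> bit) set \<Rightarrow> (real ^ 'n) set" where
  "code_lattice_plus \<alpha> C =
     zmod.span {\<alpha> i + \<alpha> j | i j. i < CARD('n) \<and> j < CARD('n)} +
     zmod.span {(1/2) *\<^sub>R code_vector \<alpha> c | c. c \<in> C}"

definition lattice_iso :: "(real ^ 'n) set \<Rightarrow> (real ^ 'n) set \<Rightarrow> bool" where
  "lattice_iso L M \<longleftrightarrow> (\<exists>f. orthogonal_transformation f \<and> f ` L = M)"

type_synonym klein = "bit \<times> bit"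

definition klein_a :: klein where "klein_a = (1, 0)"
definition klein_b :: klein where "klein_b = (0, 1)"
definition klein_c :: klein where "klein_c = (1, 1)"

definition kleinian_code :: "nat \<Rightarrow> (nat \<Rightarrow> klein) set \<Rightarrow> bool" where
  "kleinian_code m K \<longleftrightarrow>
     K \<subseteq> words m \<and> 0 \<in> K \<and> (\<forall>x\<in>K. \<forall>y\<in>K. x + y \<in> K) \<and> (\<forall>x\<in>K. - x \<in> K)"

definition even_kleinian :: "(nat \<Rightarrow> klein) set \<Rightarrow> bool" where
  "even_kleinian K \<longleftrightarrow> (\<forall>x\<in>K. even (weight x))"

definition klein_hat :: "klein \<Rightarrow> bit list" where
  "klein_hat x =
     (if x = klein_a then [1,1,0,0]
      else if x = klein_b then [1,0,1,0]
      else if x = klein_c then [0,1,1,0]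
      else [0,0,0,0])"

text \<open>The block of coordinates \<open>4j, \<dots>, 4j + 3\<close> of the binary word belongs to coordinate \<open>j\<close>.\<close>

definition hat :: "(nat \<Rightarrow> klein) \<Rightarrow> nat \<Rightarrow> bit" where
  "hat x = (\<lambda>i. klein_hat (x (i div 4)) ! (i mod 4))"

definition d4 :: "nat \<Rightarrow> (nat \<Rightarrow> bit) set" where
  "d4 m = {c \<in> words (4 * m).
     \<forall>j<m. [c (4*j), c (4*j + 1), c (4*j + 2), c (4*j + 3)] \<in> {[0,0,0,0], [1,1,1,1]}}"

definition d4_0 :: "nat \<Rightarrow> (nat \<Rightarrow> bit) set" where
  "d4_0 m = {c \<in> d4 m. 8 dvd weight c}"

definition kcode :: "nat \<Rightarrow> (nat \<Rightarrow> klein) set \<Rightarrow> (nat \<Rightarrow> bit) set" where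
  "kcode m K = hat ` K + d4 m"

definition kcode_plus :: "nat \<Rightarrow> (nat \<Rightarrow> klein) set \<Rightarrow> (nat \<Rightarrow> bit) set" where
  "kcode_plus m K = hat ` K + d4_0 m"

end

theory Submission
  imports Defs
begin

text \<open>
  In the coordinates \<open>y i = v \<bullet> \<alpha> i\<close>, the lattice of a code \<open>C\<close> consists of the integer vectors
  that reduce to \<open>C\<close> modulo 2; if \<open>C\<close> is doubly even, the plus lattice is cut out by the
  condition that the sum of the \<open>y i\<close> is divisible by 4.

  For a Kleinian code, the isometry that acts on each block of four coordinates by half a Hadamard
  matrix exchanges this condition with the condition that the number of odd last coordinates of
  the blocks is even, which defines \<open>kcode_plus\<close>.

  Conversely, let \<open>f\<close> map the plus lattice \<open>M\<close> of \<open>C\<close> onto the lattice of \<open>D\<close>. The preimage of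
  the frame \<open>\<plusminus>\<alpha> i\<close> is a frame of roots of \<open>M\<close>, and each root of \<open>M\<close> is supported on a tetrad,
  a codeword of weight 4, with entries \<open>\<plusminus>1\<close>. Reflections in roots of \<open>M\<close> move any system of
  mutually orthogonal roots into the frame. Applied to the roots supported on a maximal family of
  disjoint tetrads, this shows that the family is a partition of the coordinates: a frame root
  meeting an uncovered coordinate would be orthogonal to all of them and hence be supported on a
  further disjoint tetrad. After a permutation the tetrads are blocks, so \<open>C\<close> is
  \<open>kcode m K\<close>, and composing \<open>f\<close> with the block isometry permutes the vectors \<open>\<plusminus>\<alpha> i\<close>, so \<open>D\<close> is
  equivalent to \<open>kcode_plus m K\<close>.
\<close>

text \<open>These rules rewrite sums of bits to bitwise operations and get in the way of additivity.\<close>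

declare add_bit_eq_xor [simp del] mult_bit_eq_and [simp del]

section \<open>Bits, isometries and binary codes\<close>

lemma of_int_bit: "(of_int k :: bit) = of_bool (odd k)"
  by (cases "even k") (auto elim!: evenE oddE)

lemma of_int_bit_eq_0_iff [simp]: "(of_int k :: bit) = 0 \<longleftrightarrow> even k"
  by (simp add: of_int_bit)

lemma of_int_bit_eq_1_iff [simp]: "(of_int k :: bit) = 1 \<longleftrightarrow> odd k"
  by (simp add: of_int_bit)

lemma bit_add_self [simp]: "(x::bit) + x = 0" "x + (x + y) = y"
  by (cases x; cases y; simp)+

lemma four_dvd_int: "4 dvd int k \<longleftrightarrow> 4 dvd k"
  using int_dvd_int_iff[of 4 k] by simp

lemma orthogonal_transformation_inv:
  fixes f :: "'a::euclidean_space \<Rightarrow> 'a"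
  assumes "orthogonal_transformation f"
  shows "orthogonal_transformation (inv f)"
proof -
  have s: "f (inv f x) = x" for x
    using assms orthogonal_transformation_surj surj_f_inv_f by metis
  have i: "f x = f y \<Longrightarrow> x = y" for x y
    using assms orthogonal_transformation_inj injD by metis
  have l: "linear f" using assms by (rule orthogonal_transformation_linear)
  have "linear (inv f)"
    by (rule linearI; rule i) (simp_all add: s linear_add[OF l] linear_scale[OF l])
  then show ?thesis
    using assms s by (metis orthogonal_transformation_def)
qed

lemma lattice_iso_sym: "lattice_iso L M \<Longrightarrow> lattice_iso M L"
  unfolding lattice_iso_def
  by (metis inv_unique_comp orthogonal_transformation_inj orthogonal_transformation_inv image_inv_f_f)

lemma lattice_iso_trans: "lattice_iso L M \<Longrightarrow> lattice_iso M M' \<Longrightarrow> lattice_iso L M'"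
  unfolding lattice_iso_def by (metis image_comp orthogonal_transformation_compose)

lemma binary_codeD:
  assumes "binary_code n C"
  shows "0 \<in> C" "c \<in> C \<Longrightarrow> d \<in> C \<Longrightarrow> c + d \<in> C" "c \<in> C \<Longrightarrow> i \<ge> n \<Longrightarrow> c i = 0"
  using assms binary.subspace_0 binary.subspace_add
  unfolding binary_code_def words_def by blast+

text \<open>The only scalars are 0 and 1, so an additively closed set containing 0 is a
  subspace.\<close>

lemma binary_codeI:
  assumes "C \<subseteq> words n" "0 \<in> C" "\<And>c d. c \<in> C \<Longrightarrow> d \<in> C \<Longrightarrow> c + d \<in> C"
  shows "binary_code n C"
  unfolding binary_code_def
proof (intro conjI binary.subspaceI)
  show "(\<lambda>i. k * x i) \<in> C" if "x \<in> C" for k x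
  proof -
    have "(\<lambda>i. k * x i) = (if k = 0 then 0 else x)"
      by (cases k) (simp_all add: fun_eq_iff)
    then show ?thesis using that assms(2) by auto
  qed
qed (use assms in auto)

lemma weight_eq_sum:
  assumes "c \<in> words n"
  shows "weight c = (\<Sum>i<n. of_bool (c i \<noteq> 0))"
proof -
  have "{i. c i \<noteq> 0} = {i\<in>{..<n}. c i \<noteq> 0}"
    using assms by (force simp: words_def not_le[symmetric])
  then show ?thesis by (simp add: weight_def Int_def)
qed

lemma weight_permute:
  assumes "\<pi> permutes {..<n}"
  shows "weight (c \<circ> \<pi>) = weight c"
proof -
  have "{i. c i \<noteq> 0} = \<pi> ` {i. (c \<circ> \<pi>) i \<noteq> 0}"
    using permutes_surj[OF assms] by (auto simp: image_iff)
  then show ?thesis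
    using permutes_inj[OF assms] by (simp add: weight_def card_image inj_on_subset)
qed

lemma binary_code_equiv:
  assumes "code_equiv n C D" "binary_code n C"
  shows "binary_code n D"
proof -
  obtain \<pi> where p: "\<pi> permutes {..<n}" and D: "D = (\<lambda>c. c \<circ> \<pi>) ` C"
    using assms(1) by (auto simp: code_equiv_def)
  have add: "(c \<circ> \<pi>) + (d \<circ> \<pi>) = (c + d) \<circ> \<pi>" for c d :: "nat \<Rightarrow> bit"
    by auto
  have ge: "\<pi> i \<ge> n" if "i \<ge> n" for i
    using permutes_not_in[OF p, of i] that by simp
  note C = binary_codeD[OF assms(2)]
  show ?thesis
  proof (rule binary_codeI)
    show "D \<subseteq> words n"
      using C(3) ge by (auto simp: D words_def)
    have "0 \<circ> \<pi> = (0 :: nat \<Rightarrow> bit)" by (simp add: fun_eq_iff)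
    then show "0 \<in> D" unfolding D using C(1) by (metis imageI)
    show "c + d \<in> D" if "c \<in> D" "d \<in> D" for c d
      using that C(2) add unfolding D by blast
  qed
qed

lemma doubly_even_equiv: "code_equiv n C D \<Longrightarrow> doubly_even C \<Longrightarrow> doubly_even D"
  by (auto simp: code_equiv_def doubly_even_def weight_permute)

section \<open>Binary codes from Kleinian codes\<close>

lemma nat_mod4_cases:
  obtains j where "i = 4 * j" | j where "i = 4 * j + 1" | j where "i = 4 * j + 2" | j where "i = 4 * j + (3::nat)"
proof -
  have "i mod 4 \<in> {0, 1, 2, 3}" by auto
  then show ?thesis using that mult_div_mod_eq[of 4 i] by (metis add_0_right insertE emptyE)
qed

lemma sum_blocks4:
  "(\<Sum>i<4 * m. f i) = (\<Sum>j<m. f (4 * j) + f (4 * j + 1) + f (4 * j + 2) + f (4 * j + 3))"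
  for f :: "nat \<Rightarrow> 'a::comm_monoid_add"
  by (induction m) (simp_all add: eval_nat_numeral ac_simps)

text \<open>A bit sum counts its nonzero terms modulo 2. This turns the weight condition in
  \<open>d4_0\<close> into a linear equation.\<close>

lemma sum_bit_eq_0_iff:
  "(\<Sum>j\<in>A. g j) = 0 \<longleftrightarrow> even (\<Sum>j\<in>A. of_bool (g j \<noteq> 0) :: nat)" for g :: "'a \<Rightarrow> bit"
proof -
  have "g j = of_int (of_bool (g j \<noteq> 0))" for j by (cases "g j") simp_all
  then have "(\<Sum>j\<in>A. g j) = of_int (\<Sum>j\<in>A. of_bool (g j \<noteq> 0))"
    by (simp only: of_int_sum)
  also have "\<dots> = 0 \<longleftrightarrow> even (int (\<Sum>j\<in>A. of_bool (g j \<noteq> 0)))"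
    by (simp only: of_int_bit_eq_0_iff of_nat_sum of_nat_of_bool)
  finally show ?thesis by (simp only: even_of_nat)
qed

text \<open>The letter \<open>(p, q)\<close> is encoded as \<open>(p + q, p, q, 0)\<close>: among
  the two even words that differ by 1111 and represent the letter, the one ending in 0.\<close>

lemma hat_0: "hat x (4 * j) = fst (x j) + snd (x j)"
  and hat_1: "hat x (4 * j + 1) = fst (x j)"
  and hat_2: "hat x (4 * j + 2) = snd (x j)"
  and hat_3: "hat x (4 * j + 3) = 0"
proof -
  obtain p q where x: "x j = (p, q)" by fastforce
  show "hat x (4 * j) = fst (x j) + snd (x j)" "hat x (4 * j + 1) = fst (x j)"
    "hat x (4 * j + 2) = snd (x j)" "hat x (4 * j + 3) = 0"
    by (cases p; cases q; simp add: x hat_def klein_hat_def klein_a_def klein_b_def klein_c_def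
        del: One_nat_def add_2_eq_Suc' add_2_eq_Suc)+
qed

lemma hat_3_commuted: "hat x (3 + 4 * j) = 0"
  by (subst add.commute) (rule hat_3)

lemmas hat_simps = hat_0 hat_1 hat_2 hat_3 hat_1[simplified] hat_2[simplified]
  hat_3_commuted

lemma eq_blocks4I:
  fixes f g :: "nat \<Rightarrow> 'a"
  assumes "\<And>j. f (4 * j) = g (4 * j)" "\<And>j. f (4 * j + 1) = g (4 * j + 1)"
    "\<And>j. f (4 * j + 2) = g (4 * j + 2)" "\<And>j. f (4 * j + 3) = g (4 * j + 3)"
  shows "f = g"
proof
  show "f i = g i" for i by (cases i rule: nat_mod4_cases) (use assms in simp_all)
qed

lemma words_blocks4_iff:
  "c \<in> words (4 * m) \<longleftrightarrow>
    (\<forall>j\<ge>m. c (4 * j) = 0 \<and> c (4 * j + 1) = 0 \<and> c (4 * j + 2) = 0 \<and> c (4 * j + 3) = 0)"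
proof
  assume r: "\<forall>j\<ge>m. c (4 * j) = 0 \<and> c (4 * j + 1) = 0 \<and> c (4 * j + 2) = 0 \<and> c (4 * j + 3) = 0"
  have "c i = 0" if "i \<ge> 4 * m" for i
    using that r by (cases i rule: nat_mod4_cases) auto
  then show "c \<in> words (4 * m)" by (simp add: words_def)
qed (simp add: words_def)

text \<open>Adding the last bit of a block to all its bits makes the block end in 0; the second and
  third bits are then the components of the letter. The resulting map is additive, inverts
  \<open>hat\<close> and kills \<open>d4 m\<close>.\<close>

definition klein_part :: "(nat \<Rightarrow> bit) \<Rightarrow> nat \<Rightarrow> klein" where
  "klein_part c j = (c (4 * j + 1) + c (4 * j + 3), c (4 * j + 2) + c (4 * j + 3))"

text \<open>Generic in the alphabet: over bits this is the parity check of a block, over integers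
  and reals it is the coordinate sum that \<open>klein_map\<close> halves.\<close>

definition block_sum :: "(nat \<Rightarrow> 'a::plus) \<Rightarrow> nat \<Rightarrow> 'a" where
  "block_sum c j = c (4 * j) + c (4 * j + 1) + c (4 * j + 2) + c (4 * j + 3)"

lemma klein_part_0 [simp]: "klein_part 0 = 0"
  by (simp add: klein_part_def fun_eq_iff zero_prod_def)

lemma klein_part_add: "klein_part (c + d) = klein_part c + klein_part d"
  by (simp add: klein_part_def fun_eq_iff add_ac)

lemma klein_part_hat [simp]: "klein_part (hat x) = x"
  by (simp add: klein_part_def fun_eq_iff hat_simps)

lemma block_sum_0 [simp]: "block_sum 0 j = (0 :: 'a::comm_monoid_add)"
  by (simp add: block_sum_def)

lemma block_sum_add: "block_sum (c + d) j = block_sum c j + block_sum d j"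
  for c d :: "nat \<Rightarrow> 'a::comm_monoid_add"
  by (simp add: block_sum_def add_ac)

lemma block_sum_hat [simp]: "block_sum (hat x) j = 0"
  by (simp add: block_sum_def hat_simps add_ac)

lemma d4_iff:
  "d \<in> d4 m \<longleftrightarrow> d \<in> words (4 * m) \<and>
    (\<forall>j. d (4 * j) = d (4 * j + 3) \<and> d (4 * j + 1) = d (4 * j + 3) \<and> d (4 * j + 2) = d (4 * j + 3))"
proof -
  have "[d (4*j), d (4*j + 1), d (4*j + 2), d (4*j + 3)] \<in> {[0,0,0,0], [1,1,1,1]} \<longleftrightarrow>
    d (4 * j) = d (4 * j + 3) \<and> d (4 * j + 1) = d (4 * j + 3) \<and> d (4 * j + 2) = d (4 * j + 3)" for j
    by (cases "d (4*j+3)") auto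
  then show ?thesis
    unfolding d4_def by (auto simp: words_blocks4_iff) (metis not_le)+
qed

lemma weight_blocks4:
  "c \<in> words (4 * m) \<Longrightarrow> weight c = (\<Sum>j<m. of_bool (c (4 * j) \<noteq> 0) + of_bool (c (4 * j + 1) \<noteq> 0)
    + of_bool (c (4 * j + 2) \<noteq> 0) + of_bool (c (4 * j + 3) \<noteq> 0))"
  unfolding weight_eq_sum by (rule sum_blocks4)

text \<open>A word of \<open>d4 m\<close> has weight four times its number of nonzero blocks, and
  its last bit tells whether a block is nonzero.\<close>

lemma d4_0_iff: "d \<in> d4_0 m \<longleftrightarrow> d \<in> d4 m \<and> (\<Sum>j<m. d (4 * j + 3)) = 0"
proof -
  have "weight d = 4 * (\<Sum>j<m. of_bool (d (4 * j + 3) \<noteq> 0))" if "d \<in> d4 m"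
  proof -
    have w: "d \<in> words (4 * m)"
      and e: "d (4 * j) = d (4 * j + 3)" "d (4 * j + 1) = d (4 * j + 3)" "d (4 * j + 2) = d (4 * j + 3)" for j
      using that unfolding d4_iff by blast+
    have "4 * x = x + x + x + x" for x :: nat by simp
    then show ?thesis
      unfolding weight_blocks4[OF w] e sum.distrib by metis
  qed
  moreover have "8 dvd 4 * k \<longleftrightarrow> even k" for k :: nat by presburger
  ultimately show ?thesis
    unfolding d4_0_def mem_Collect_eq sum_bit_eq_0_iff by metis
qed

lemma hat_words: "x \<in> words m \<Longrightarrow> hat x \<in> words (4 * m)"
  by (simp add: words_blocks4_iff hat_simps) (simp add: words_def)

text \<open>An even block differs from the representative ending in 0 by 0000 or 1111, according to
  its own last bit.\<close>

lemma hat_klein_part_diff: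
  assumes c: "c \<in> words (4 * m)" "\<And>j. block_sum c j = 0"
  shows "c + hat (klein_part c) \<in> d4 m" "\<And>j. (c + hat (klein_part c)) (4 * j + 3) = c (4 * j + 3)"
proof -
  let ?d = "c + hat (klein_part c)"
  have "klein_part c \<in> words m"
    using c(1) by (simp add: words_blocks4_iff klein_part_def) (simp add: words_def zero_prod_def klein_part_def)
  then have "?d \<in> words (4 * m)" using c(1) hat_words[of "klein_part c" m] by (auto simp: words_def)
  moreover have "?d (4 * j) = block_sum c j + c (4 * j + 3)" for j
    unfolding plus_fun_apply hat_0 klein_part_def block_sum_def fst_conv snd_conv
    by (cases "c (4 * j)"; cases "c (4 * j + 1)"; cases "c (4 * j + 2)"; cases "c (4 * j + 3)")
      simp_all
  moreover have "?d (4 * j + 1) = c (4 * j + 3)" "?d (4 * j + 2) = c (4 * j + 3)" for j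
    unfolding plus_fun_apply hat_1 hat_2 klein_part_def fst_conv snd_conv by (rule bit_add_self)+
  moreover show d3: "?d (4 * j + 3) = c (4 * j + 3)" for j
    unfolding plus_fun_apply hat_3 by (rule add_0_right)
  ultimately show "?d \<in> d4 m"
    using c(2) unfolding d4_iff d3 by (metis add_0_left)
qed

lemma d4_klein_part:
  assumes "d \<in> d4 m" shows "klein_part d = 0" "block_sum d j = 0"
  using assms by (auto simp: d4_iff klein_part_def fun_eq_iff zero_prod_def block_sum_def add.assoc)

text \<open>The even words of a block modulo 1111 form the Kleinian group, with
  \<open>klein_part\<close> as quotient map; the code is the full preimage of \<open>K\<close> among
  the words with even blocks.\<close>

lemma mem_kcode:
  assumes K: "K \<subseteq> words m"
  shows "c \<in> kcode m K \<longleftrightarrow> c \<in> words (4 * m) \<and> (\<forall>j. block_sum c j = 0) \<and> klein_part c \<in> K"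
proof
  assume "c \<in> kcode m K"
  then obtain x d where c: "c = hat x + d" "x \<in> K" "d \<in> d4 m"
    by (auto simp: kcode_def set_plus_def)
  moreover have "hat x \<in> words (4 * m)" using c K hat_words by blast
  ultimately show "c \<in> words (4 * m) \<and> (\<forall>j. block_sum c j = 0) \<and> klein_part c \<in> K"
    by (simp add: block_sum_add klein_part_add d4_klein_part) (simp add: d4_iff words_def)
next
  assume c: "c \<in> words (4 * m) \<and> (\<forall>j. block_sum c j = 0) \<and> klein_part c \<in> K"
  have "c = hat (klein_part c) + (c + hat (klein_part c))"
    by (simp add: fun_eq_iff add_ac)
  then show "c \<in> kcode m K"
    using c hat_klein_part_diff(1)[of c m] unfolding kcode_def by (metis imageI set_plus_intro)
qed

text \<open>Encoded letters end in 0, so the last coordinates of the blocks come from the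
  \<open>d4\<close> summand alone, and their sum decides whether that summand lies in
  \<open>d4_0\<close>.\<close>

lemma mem_kcode_plus:
  assumes K: "K \<subseteq> words m"
  shows "c \<in> kcode_plus m K \<longleftrightarrow> c \<in> kcode m K \<and> (\<Sum>j<m. c (4 * j + 3)) = 0"
proof
  assume "c \<in> kcode_plus m K"
  then obtain x d where c: "c = hat x + d" "x \<in> K" "d \<in> d4_0 m"
    by (auto simp: kcode_plus_def set_plus_def)
  then show "c \<in> kcode m K \<and> (\<Sum>j<m. c (4 * j + 3)) = 0"
    by (auto simp: kcode_def d4_0_iff sum.distrib hat_simps)
next
  assume c: "c \<in> kcode m K \<and> (\<Sum>j<m. c (4 * j + 3)) = 0"
  then have c': "c \<in> words (4 * m)" "\<And>j. block_sum c j = 0" "klein_part c \<in> K"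
    using mem_kcode[OF K] by auto
  have "c = hat (klein_part c) + (c + hat (klein_part c))"
    by (simp add: fun_eq_iff add_ac)
  moreover have "c + hat (klein_part c) \<in> d4_0 m"
    using c hat_klein_part_diff[OF c'(1,2)] by (simp add: d4_0_iff hat_3)
  ultimately show "c \<in> kcode_plus m K"
    using c' unfolding kcode_plus_def by (metis imageI set_plus_intro)
qed

lemma binary_code_kcode:
  assumes "kleinian_code m K" shows "binary_code (4 * m) (kcode m K)"
proof (rule binary_codeI)
  have K: "K \<subseteq> words m" "0 \<in> K" "\<And>x y. x \<in> K \<Longrightarrow> y \<in> K \<Longrightarrow> x + y \<in> K"
    using assms by (auto simp: kleinian_code_def)
  note mem = mem_kcode[OF K(1)]
  show "kcode m K \<subseteq> words (4 * m)" by (auto simp: mem)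
  show "0 \<in> kcode m K" using K(2) by (simp add: mem words_def)
  show "c + d \<in> kcode m K" if "c \<in> kcode m K" "d \<in> kcode m K" for c d
    using that K(3) by (simp add: mem words_def block_sum_add klein_part_add)
qed

lemma binary_code_kcode_plus:
  assumes "kleinian_code m K" shows "binary_code (4 * m) (kcode_plus m K)"
proof (rule binary_codeI)
  have K: "K \<subseteq> words m" using assms by (simp add: kleinian_code_def)
  note mem = mem_kcode_plus[OF K] and C = binary_code_kcode[OF assms]
  show "kcode_plus m K \<subseteq> words (4 * m)" using C mem by (auto simp: binary_code_def)
  show "0 \<in> kcode_plus m K" using binary_codeD(1)[OF C] by (simp add: mem)
  show "c + d \<in> kcode_plus m K" if "c \<in> kcode_plus m K" "d \<in> kcode_plus m K" for c d
    using that binary_codeD(2)[OF C] by (simp add: mem sum.distrib)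
qed

text \<open>Each nonzero letter is encoded with weight 2. This is how doubly even binary codes
  correspond to even Kleinian codes.\<close>

lemma weight_hat:
  assumes "x \<in> words m" shows "weight (hat x) = 2 * weight x"
proof -
  have "of_bool (hat x (4 * j) \<noteq> 0) + of_bool (hat x (4 * j + 1) \<noteq> 0)
    + of_bool (hat x (4 * j + 2) \<noteq> 0) + of_bool (hat x (4 * j + 3) \<noteq> 0) = (2 * of_bool (x j \<noteq> 0) :: nat)" for j
  proof -
    obtain p q where "x j = (p, q)" by fastforce
    then show ?thesis
      by (cases p; cases q; simp only: hat_0 hat_1 hat_2 hat_3) (simp_all add: zero_prod_def)
  qed
  then show ?thesis
    by (simp only: weight_blocks4[OF hat_words[OF assms]] weight_eq_sum[OF assms] sum_distrib_left)
qed

section \<open>Disjoint families of sets and partitions into quadruples\<close>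

lemma obtain_maximal_disjoint:
  assumes A: "finite A"
  obtains P where "P \<subseteq> A" "pairwise disjnt P"
    "\<And>T. T \<in> A \<Longrightarrow> (\<And>S. S \<in> P \<Longrightarrow> disjnt T S) \<Longrightarrow> T \<in> P"
proof -
  define F where "F = {P. P \<subseteq> A \<and> pairwise disjnt P}"
  have mem: "P \<in> F \<longleftrightarrow> P \<subseteq> A \<and> pairwise disjnt P" for P by (simp add: F_def)
  have "F \<subseteq> Pow A" unfolding F_def by blast
  then have "finite F" by (rule finite_subset) (simp add: A)
  moreover have "F \<noteq> {}" using mem[of "{}"] pairwise_empty by blast
  ultimately have "\<exists>P\<in>F. \<forall>Q\<in>F. P \<le> Q \<longrightarrow> P = Q" by (rule finite_has_maximal)
  then obtain P where P: "P \<in> F" and max: "\<And>Q. Q \<in> F \<Longrightarrow> P \<subseteq> Q \<Longrightarrow> P = Q" by blast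
  have "T \<in> P" if T: "T \<in> A" and disj: "\<And>S. S \<in> P \<Longrightarrow> disjnt T S" for T
  proof -
    have "insert T P \<in> F"
      using P T disj disjnt_sym unfolding mem pairwise_insert by blast
    then have "P = insert T P" by (rule max) blast
    then show ?thesis by blast
  qed
  then show ?thesis using that P unfolding mem by blast
qed

lemma sum_block4:
  fixes f :: "nat \<Rightarrow> 'a::comm_monoid_add"
  shows "(\<Sum>i\<in>{4 * j..<4 * j + 4}. f i) = f (4 * j) + f (4 * j + 1) + f (4 * j + 2) + f (4 * j + 3)"
proof -
  have "{4 * j..<4 * j + 4} = {4 * j, 4 * j + 1, 4 * j + 2, 4 * j + 3}" by auto
  then show ?thesis by (simp add: add.assoc)
qed

lemma hat_add: "hat (x + y) = hat x + hat y"
  by (rule eq_blocks4I) (simp_all only: plus_fun_apply hat_0 hat_1 hat_2 hat_3 fst_add snd_add add_0_left, simp only: add_ac)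

lemma hat_zero [simp]: "hat 0 = 0"
  by (rule eq_blocks4I) (simp_all only: zero_fun_apply hat_0 hat_1 hat_2 hat_3 fst_zero snd_zero add_0_left)

lemma klein_part_words: "c \<in> words (4 * m) \<Longrightarrow> klein_part c \<in> words m"
  by (simp add: words_def klein_part_def zero_prod_def)

lemma partition_into_quadruples:
  fixes P :: "nat set set"
  assumes P: "\<Union>P = {..<n}" "pairwise disjnt P" "\<And>T. T \<in> P \<Longrightarrow> card T = 4"
  obtains m \<pi> where "n = 4 * m" "\<pi> permutes {..<n}" "\<forall>j<m. \<pi> ` {4 * j..<4 * j + 4} \<in> P"
proof -
  have finP: "finite P" using P(1) by (metis finite_UnionD finite_lessThan)
  have finT: "finite T" if "T \<in> P" for T using P(3)[OF that] card.infinite by fastforce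
  let ?m = "card P"
  have "card (\<Union>P) = (\<Sum>T\<in>P. card T)"
    using P(2) finT by (rule card_Union_disjoint)
  then have n: "n = 4 * ?m" using P(1,3) by simp
  obtain h where h: "bij_betw h {0..<?m} P" using finP ex_bij_betw_nat_finite by blast
  have "\<forall>T. \<exists>e. T \<in> P \<longrightarrow> bij_betw e {0..<4::nat} T"
    using finT P(3) ex_bij_betw_nat_finite by metis
  then obtain e where e: "\<And>T. T \<in> P \<Longrightarrow> bij_betw (e T) {0..<4::nat} T" by metis
  \<comment> \<open>\<open>h\<close> numbers the members of the partition and \<open>e T\<close> the
    elements of \<open>T\<close>; the quotient of \<open>i\<close> by 4 selects the member and the
    remainder the element.\<close>
  define \<pi> where "\<pi> i = (if i < n then e (h (i div 4)) (i mod 4) else i)" for i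
  have hP: "h j \<in> P" if "j < ?m" for j using h that by (auto simp: bij_betw_def)
  have block: "\<pi> ` {4 * j..<4 * j + 4} = h j" if j: "j < ?m" for j
  proof -
    have "\<pi> (4 * j + k) = e (h j) k" if "k < 4" for k
      using that j n by (simp add: \<pi>_def)
    then have "(\<lambda>k. \<pi> (4 * j + k)) ` {0..<4} = e (h j) ` {0..<4}"
      by (intro image_cong) simp_all
    moreover have "(\<lambda>k. 4 * j + k) ` {0..<4} = {4 * j..<4 * j + 4}"
      by (simp add: add.commute)
    then have "(\<lambda>k. \<pi> (4 * j + k)) ` {0..<4} = \<pi> ` {4 * j..<4 * j + 4}"
      by (metis image_image)
    ultimately show ?thesis using e[OF hP[OF j]] by (simp add: bij_betw_def)
  qed
  have "\<pi> ` {..<n} = {..<n}"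
  proof
    show "{..<n} \<subseteq> \<pi> ` {..<n}"
    proof
      fix x assume "x \<in> {..<n}"
      then obtain T where T: "T \<in> P" "x \<in> T" using P(1) by blast
      then obtain j where j: "j < ?m" "h j = T" using h by (metis atLeastLessThan_iff bij_betw_iff_bijections)
      then have "x \<in> \<pi> ` {4 * j..<4 * j + 4}" using block T by simp
      moreover have "{4 * j..<4 * j + 4} \<subseteq> {..<n}" using j n by auto
      ultimately show "x \<in> \<pi> ` {..<n}" by blast
    qed
    have "\<pi> i < n" if i: "i < n" for i
    proof -
      have "i div 4 < ?m" using i n by simp
      moreover have "i \<in> {4 * (i div 4)..<4 * (i div 4) + 4}" by simp
      ultimately have "\<pi> i \<in> h (i div 4)" "h (i div 4) \<in> P" using block hP by blast+
      then show ?thesis using P(1) by blast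
    qed
    then show "\<pi> ` {..<n} \<subseteq> {..<n}" by auto
  qed
  then have "bij_betw \<pi> {..<n} {..<n}"
    by (simp add: bij_betw_def eq_card_imp_inj_on)
  then have "\<pi> permutes {..<n}"
    by (rule bij_imp_permutes) (simp add: \<pi>_def)
  then show ?thesis using that n block hP by metis
qed

section \<open>Lattices in coordinates\<close>

locale norm2_frame =
  fixes n :: nat and \<alpha> :: "nat \<Rightarrow> real ^ 'n"
  assumes n: "n = CARD('n)" and basis: "norm2_orthogonal_basis \<alpha>"
begin

lemma inner_frame: "i < n \<Longrightarrow> j < n \<Longrightarrow> \<alpha> i \<bullet> \<alpha> j = (if i = j then 2 else 0)"
  using basis by (auto simp: norm2_orthogonal_basis_def n orthogonal_def)

text \<open>The difference is orthogonal to a spanning set, hence to itself.\<close>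

lemma frame_eqI:
  assumes "\<And>i. i < n \<Longrightarrow> u \<bullet> \<alpha> i = v \<bullet> \<alpha> i"
  shows "u = v"
proof -
  have "u - v \<in> span (\<alpha> ` {..<n})"
    using basis by (simp add: norm2_orthogonal_basis_def flip: n)
  then have "orthogonal (u - v) (u - v)"
    by (rule orthogonal_to_span) (use assms in \<open>auto simp: orthogonal_def inner_diff_left\<close>)
  then show ?thesis by (simp add: orthogonal_def)
qed

text \<open>The frame vectors have norm 2, so the factor 1/2 makes \<open>y\<close> the family of
  inner products with the frame.\<close>

definition vec_of :: "(nat \<Rightarrow> real) \<Rightarrow> real ^ 'n" where
  "vec_of y = (\<Sum>i<n. (y i / 2) *\<^sub>R \<alpha> i)"

lemma inner_vec_of [simp]: "i < n \<Longrightarrow> vec_of y \<bullet> \<alpha> i = y i"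
proof -
  assume i: "i < n"
  have "vec_of y \<bullet> \<alpha> i = (\<Sum>j<n. if j = i then y i else 0)"
    unfolding vec_of_def inner_sum_left
    by (rule sum.cong) (use i in \<open>auto simp: inner_frame\<close>)
  then show ?thesis using i by simp
qed

lemma vec_of_inner: "vec_of (\<lambda>i. v \<bullet> \<alpha> i) = v"
  by (rule frame_eqI) simp

lemma inner_eq_sum: "u \<bullet> v = (\<Sum>i<n. (u \<bullet> \<alpha> i) * (v \<bullet> \<alpha> i)) / 2"
proof -
  have "u \<bullet> v = u \<bullet> vec_of (\<lambda>i. v \<bullet> \<alpha> i)" by (simp add: vec_of_inner)
  also have "\<dots> = (\<Sum>i<n. (u \<bullet> \<alpha> i) * (v \<bullet> \<alpha> i)) / 2"
    unfolding vec_of_def inner_sum_right sum_divide_distrib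
    by (rule sum.cong) auto
  finally show ?thesis .
qed

text \<open>On an \<open>integral_vec\<close> the floor changes nothing; it only makes the value an
  integer. The default 0 from \<open>n\<close> on makes \<open>word v\<close> a word of length
  \<open>n\<close>.\<close>

definition coord :: "real ^ 'n \<Rightarrow> nat \<Rightarrow> int" where
  "coord v i = (if i < n then \<lfloor>v \<bullet> \<alpha> i\<rfloor> else 0)"

definition integral_vec :: "real ^ 'n \<Rightarrow> bool" where
  "integral_vec v \<longleftrightarrow> (\<forall>i<n. v \<bullet> \<alpha> i \<in> \<int>)"

definition word :: "real ^ 'n \<Rightarrow> nat \<Rightarrow> bit" where
  "word v = (\<lambda>i. of_int (coord v i))"

lemma of_int_coord: "integral_vec v \<Longrightarrow> i < n \<Longrightarrow> of_int (coord v i) = v \<bullet> \<alpha> i"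
  by (auto simp: integral_vec_def coord_def)

lemma coord_ge [simp]: "i \<ge> n \<Longrightarrow> coord v i = 0"
  by (simp add: coord_def)

lemma word_ge [simp]: "i \<ge> n \<Longrightarrow> word v i = 0"
  by (simp add: word_def)

lemma coordI: "v \<bullet> \<alpha> i = of_int k \<Longrightarrow> i < n \<Longrightarrow> coord v i = k"
  by (auto simp: coord_def)

lemma integral_vec_add [simp]: "integral_vec u \<Longrightarrow> integral_vec v \<Longrightarrow> integral_vec (u + v)"
  by (auto simp: integral_vec_def inner_add_left)

lemma integral_vec_diff [simp]: "integral_vec u \<Longrightarrow> integral_vec v \<Longrightarrow> integral_vec (u - v)"
  by (auto simp: integral_vec_def inner_diff_left)

lemma integral_vec_scale [simp]: "integral_vec v \<Longrightarrow> integral_vec (of_int k *\<^sub>R v)"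
  by (auto simp: integral_vec_def)

lemma integral_vec_0 [simp]: "integral_vec 0"
  by (simp add: integral_vec_def)

lemma coord_add: "integral_vec u \<Longrightarrow> integral_vec v \<Longrightarrow> coord (u + v) i = coord u i + coord v i"
  by (cases "i < n") (auto intro!: coordI simp: inner_add_left of_int_coord)

lemma coord_diff: "integral_vec u \<Longrightarrow> integral_vec v \<Longrightarrow> coord (u - v) i = coord u i - coord v i"
  by (cases "i < n") (auto intro!: coordI simp: inner_diff_left of_int_coord)

lemma coord_scale: "integral_vec v \<Longrightarrow> coord (of_int k *\<^sub>R v) i = k * coord v i"
  by (cases "i < n") (auto intro!: coordI simp: of_int_coord)

lemma word_add: "integral_vec u \<Longrightarrow> integral_vec v \<Longrightarrow> word (u + v) = word u + word v"
  by (simp add: word_def fun_eq_iff coord_add)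

lemma word_scale: "integral_vec v \<Longrightarrow> word (of_int k *\<^sub>R v) = (if even k then 0 else word v)"
  by (simp add: word_def fun_eq_iff coord_scale of_int_bit)

lemma coord_0 [simp]: "coord 0 i = 0"
  by (simp add: coord_def)

lemma word_0 [simp]: "word 0 = 0"
  by (simp add: word_def fun_eq_iff)

lemma integral_vec_frame [simp]: "i < n \<Longrightarrow> integral_vec (\<alpha> i)"
  by (auto simp: integral_vec_def inner_frame)

lemma coord_frame: "i < n \<Longrightarrow> coord (\<alpha> i) j = (if i = j then 2 else 0)"
  by (auto simp: coord_def inner_frame)

lemma word_frame [simp]: "i < n \<Longrightarrow> word (\<alpha> i) = 0"
  by (auto simp: word_def coord_frame)

definition half_vec :: "(nat \<Rightarrow> bit) \<Rightarrow> real ^ 'n" where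
  "half_vec c = (1/2) *\<^sub>R code_vector \<alpha> c"

lemma half_vec_eq: "half_vec c = vec_of (\<lambda>i. of_bool (c i = 1))"
  by (auto simp: half_vec_def code_vector_def vec_of_def scaleR_sum_right simp flip: n intro!: sum.cong)

lemma inner_half_vec: "i < n \<Longrightarrow> half_vec c \<bullet> \<alpha> i = of_bool (c i = 1)"
  by (simp add: half_vec_eq)

lemma integral_half_vec [simp]: "integral_vec (half_vec c)"
  by (auto simp: integral_vec_def inner_half_vec)

lemma coord_half_vec: "i < n \<Longrightarrow> coord (half_vec c) i = of_bool (c i = 1)"
  by (simp add: coord_def inner_half_vec)

lemma word_half_vec: "c \<in> words n \<Longrightarrow> word (half_vec c) = c"
proof
  fix i assume c: "c \<in> words n"
  show "word (half_vec c) i = c i"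
    using c by (cases "i < n"; cases "c i") (auto simp: word_def coord_half_vec words_def)
qed

lemma zmod_span_set_plus: "zmod.span A + zmod.span B = zmod.span (A \<union> B)"
  by (auto simp: zmod.span_Un set_plus_def)

lemma zmod_span_sum_scale:
  "(\<And>i. i < n \<Longrightarrow> b i \<in> zmod.span S) \<Longrightarrow> (\<Sum>i<n. of_int (z i) *\<^sub>R b i) \<in> zmod.span S"
  by (auto intro!: zmod.span_sum zmod.span_scale)

text \<open>\<open>half_vec (word v)\<close> has coordinates 0 and 1 and leaves an even remainder.
  Since \<open>\<alpha> i\<close> has the single nonzero coordinate 2, the remainder is an integral
  combination of the frame.\<close>

lemma word_decomp:
  assumes "integral_vec v"
  obtains z :: "nat \<Rightarrow> int"
  where "v = half_vec (word v) + (\<Sum>i<n. of_int (z i) *\<^sub>R \<alpha> i)"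
    and "\<And>i. i < n \<Longrightarrow> coord v i = of_bool (word v i = 1) + 2 * z i"
proof
  let ?z = "\<lambda>i. coord v i div 2"
  show c: "coord v i = of_bool (word v i = 1) + 2 * ?z i" if "i < n" for i
    by (simp add: word_def) presburger
  have "real_of_int (coord v i) = of_bool (word v i = 1) + 2 * real_of_int (?z i)" if "i < n" for i
    using arg_cong[OF c[OF that], of real_of_int] by simp
  then have "v - half_vec (word v) = vec_of (\<lambda>i. 2 * ?z i)"
    by (intro frame_eqI)
      (simp add: inner_diff_left inner_half_vec flip: of_int_coord[OF assms])
  then show "v = half_vec (word v) + (\<Sum>i<n. of_int (?z i) *\<^sub>R \<alpha> i)"
    by (simp add: vec_of_def algebra_simps)
qed

text \<open>This is Construction A: reduction modulo 2 is additive on integral vectors, its kernel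
  is the integral span of the frame, and \<open>half_vec\<close> lifts codewords.\<close>

lemma mem_code_lattice:
  assumes C: "binary_code n C"
  shows "v \<in> code_lattice \<alpha> C \<longleftrightarrow> integral_vec v \<and> word v \<in> C"
proof
  let ?G = "{\<alpha> i | i. i < n} \<union> {(1/2) *\<^sub>R code_vector \<alpha> c | c. c \<in> C}"
  have L: "code_lattice \<alpha> C = zmod.span ?G"
    by (simp add: code_lattice_def zmod_span_set_plus flip: n)
  {
    assume "v \<in> code_lattice \<alpha> C"
    moreover have "zmod.span ?G \<subseteq> {v. integral_vec v \<and> word v \<in> C}"
    proof (rule zmod.span_minimal)
      show "?G \<subseteq> {v. integral_vec v \<and> word v \<in> C}"
        using C binary_codeD[OF C] word_half_vec
        by (auto simp: half_vec_def[symmetric] binary_code_def subset_iff)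
      show "zmod.subspace {v. integral_vec v \<and> word v \<in> C}"
        using binary_codeD[OF C]
        by (intro zmod.subspaceI) (auto simp: word_add word_scale)
    qed
    ultimately show "integral_vec v \<and> word v \<in> C" using L by blast
  }
  {
    assume v: "integral_vec v \<and> word v \<in> C"
    then obtain z :: "nat \<Rightarrow> int" where z: "v = half_vec (word v) + (\<Sum>i<n. of_int (z i) *\<^sub>R \<alpha> i)"
      using word_decomp by metis
    have "half_vec (word v) + (\<Sum>i<n. of_int (z i) *\<^sub>R \<alpha> i) \<in> zmod.span ?G"
      using v by (intro zmod.span_add zmod_span_sum_scale) (auto intro!: zmod.span_base simp: half_vec_def)
    then show "v \<in> code_lattice \<alpha> C" using L z by simp
  }
qed

lemma sum_coord_half_vec: "c \<in> words n \<Longrightarrow> (\<Sum>i<n. coord (half_vec c) i) = int (weight c)"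
  by (simp add: weight_eq_sum coord_half_vec)

text \<open>The coordinate sum is additive, equals 4 on \<open>\<alpha> i + \<alpha> j\<close> and
  equals the weight of \<open>c\<close> on \<open>half_vec c\<close>. Conversely, if it is divisible
  by 4, the frame part of the decomposition has an even coefficient sum.\<close>

lemma mem_code_lattice_plus:
  assumes C: "binary_code n C" "doubly_even C"
  shows "v \<in> code_lattice_plus \<alpha> C \<longleftrightarrow>
    integral_vec v \<and> word v \<in> C \<and> 4 dvd (\<Sum>i<n. coord v i)"
proof
  let ?G = "{\<alpha> i + \<alpha> j | i j. i < n \<and> j < n} \<union> {(1/2) *\<^sub>R code_vector \<alpha> c | c. c \<in> C}"
  let ?R = "{v. integral_vec v \<and> word v \<in> C \<and> 4 dvd (\<Sum>i<n. coord v i)}"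
  have L: "code_lattice_plus \<alpha> C = zmod.span ?G"
    by (simp add: code_lattice_plus_def zmod_span_set_plus flip: n)
  have Cw: "c \<in> words n" if "c \<in> C" for c
    using that C by (auto simp: binary_code_def)
  {
    assume "v \<in> code_lattice_plus \<alpha> C"
    moreover have "zmod.span ?G \<subseteq> ?R"
    proof (rule zmod.span_minimal)
      have "\<alpha> i + \<alpha> j \<in> ?R" if "i < n" "j < n" for i j
        using that binary_codeD(1)[OF C(1)] by (simp add: word_add coord_add coord_frame sum.distrib)
      moreover have "half_vec c \<in> ?R" if "c \<in> C" for c
        using that C(2) Cw word_half_vec
        by (simp add: sum_coord_half_vec doubly_even_def four_dvd_int)
      ultimately show "?G \<subseteq> ?R" unfolding half_vec_def by blast
      show "zmod.subspace ?R"
      proof (rule zmod.subspaceI)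
        show "0 \<in> ?R" using binary_codeD(1)[OF C(1)] by simp
        show "x + y \<in> ?R" if "x \<in> ?R" "y \<in> ?R" for x y
          using that binary_codeD(2)[OF C(1)] by (simp add: word_add coord_add sum.distrib)
        show "of_int k *\<^sub>R x \<in> ?R" if "x \<in> ?R" for k x
          using that binary_codeD(1)[OF C(1)]
          by (simp add: word_scale coord_scale flip: sum_distrib_left)
      qed
    qed
    ultimately show "integral_vec v \<and> word v \<in> C \<and> 4 dvd (\<Sum>i<n. coord v i)" using L by blast
  }
  {
    assume v: "integral_vec v \<and> word v \<in> C \<and> 4 dvd (\<Sum>i<n. coord v i)"
    then obtain z :: "nat \<Rightarrow> int" where z: "v = half_vec (word v) + (\<Sum>i<n. of_int (z i) *\<^sub>R \<alpha> i)"
      and zc: "\<And>i. i < n \<Longrightarrow> coord v i = of_bool (word v i = 1) + 2 * z i"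
      using word_decomp by metis
    have "(\<Sum>i<n. coord v i) = int (weight (word v)) + 2 * (\<Sum>i<n. z i)"
      using v by (simp add: zc sum.distrib weight_eq_sum[OF Cw] sum_distrib_left)
    moreover have "4 dvd int (weight (word v))"
      using C(2) v by (auto simp: doubly_even_def four_dvd_int)
    ultimately have "4 dvd 2 * (\<Sum>i<n. z i)"
      using v by (simp only: dvd_add_right_iff)
    then have "even (\<Sum>i<n. z i)" by presburger
    then obtain s where s: "(\<Sum>i<n. z i) = 2 * s" by (rule evenE)
    have n0: "0 < n" by (simp add: n)
    \<comment> \<open>Replacing each \<open>\<alpha> i\<close> by
      \<open>\<alpha> i + \<alpha> 0\<close> adds \<open>2 * s\<close> copies of
      \<open>\<alpha> 0\<close>, which are removed as \<open>s\<close> copies of the generator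
      \<open>\<alpha> 0 + \<alpha> 0\<close>.\<close>
    have "(\<Sum>i<n. of_int (z i) *\<^sub>R \<alpha> i) =
      (\<Sum>i<n. of_int (z i) *\<^sub>R (\<alpha> i + \<alpha> 0)) + of_int (- s) *\<^sub>R (\<alpha> 0 + \<alpha> 0)"
    proof -
      have "(\<Sum>i<n. of_int (z i) *\<^sub>R \<alpha> 0) = (of_int (\<Sum>i<n. z i) :: real) *\<^sub>R \<alpha> 0"
        by (simp add: scaleR_sum_left)
      then show ?thesis
        by (simp add: s scaleR_add_right sum.distrib flip: scaleR_2)
    qed
    moreover have a: "\<alpha> i + \<alpha> 0 \<in> zmod.span ?G" if "i < n" for i
      by (rule zmod.span_base, rule UnI1) (use that n0 in blast)
    have "(\<Sum>i<n. of_int (z i) *\<^sub>R (\<alpha> i + \<alpha> 0)) + of_int (- s) *\<^sub>R (\<alpha> 0 + \<alpha> 0) \<in> zmod.span ?G"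
      by (rule zmod.span_add[OF zmod_span_sum_scale[OF a] zmod.span_scale[OF a[OF n0]]])
    moreover have "half_vec (word v) \<in> zmod.span ?G"
      by (rule zmod.span_base) (use v in \<open>auto simp: half_vec_def\<close>)
    ultimately have "half_vec (word v) + (\<Sum>i<n. of_int (z i) *\<^sub>R \<alpha> i) \<in> zmod.span ?G"
      by (simp only: zmod.span_add)
    then show "v \<in> code_lattice_plus \<alpha> C" using L z by simp
  }
qed

lemma code_lattice_plus_subset:
  "binary_code n C \<Longrightarrow> doubly_even C \<Longrightarrow> code_lattice_plus \<alpha> C \<subseteq> code_lattice \<alpha> C"
  by (auto simp: mem_code_lattice mem_code_lattice_plus)

lemma zmod_subspace_code_lattice: "zmod.subspace (code_lattice \<alpha> C)"
  by (simp add: code_lattice_def zmod_span_set_plus)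

lemma zmod_subspace_code_lattice_plus: "zmod.subspace (code_lattice_plus \<alpha> C)"
  by (simp add: code_lattice_plus_def zmod_span_set_plus)

lemma frame_mem_code_lattice: "binary_code n C \<Longrightarrow> i < n \<Longrightarrow> \<alpha> i \<in> code_lattice \<alpha> C"
  by (simp add: mem_code_lattice binary_codeD)

lemma inner_self_coord:
  "integral_vec v \<Longrightarrow> v \<bullet> v = of_int (\<Sum>i<n. (coord v i)\<^sup>2) / 2"
  by (simp add: inner_eq_sum[of v v] power2_eq_square of_int_coord)

text \<open>A square is 0 or 1 modulo 4 according to parity, so the sum of the squared coordinates,
  which is twice the norm, is congruent to the weight of \<open>word v\<close> modulo 4.\<close>

lemma code_lattice_even:
  assumes C: "binary_code n C" "doubly_even C" and v: "v \<in> code_lattice \<alpha> C"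
  shows "(v \<bullet> v) / 2 \<in> \<int>"
proof -
  have iv: "integral_vec v" and wv: "word v \<in> C" using v C by (auto simp: mem_code_lattice)
  then have w: "word v \<in> words n" using C by (auto simp: binary_code_def)
  have "4 dvd (coord v i)\<^sup>2 - of_bool (word v i \<noteq> 0)" for i
  proof (cases "even (coord v i)")
    case True
    then obtain k where "coord v i = 2 * k" by (rule evenE)
    then have "(coord v i)\<^sup>2 - of_bool (word v i \<noteq> 0) = 4 * (k * k)"
      by (simp add: word_def power2_eq_square)
    then show ?thesis by simp
  next
    case False
    then obtain k where k: "coord v i = 2 * k + 1" by (rule oddE)
    have "(coord v i)\<^sup>2 - of_bool (word v i \<noteq> 0) = 4 * (k * k + k)"
      using False by (simp add: word_def k power2_eq_square algebra_simps)
    then show ?thesis by simp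
  qed
  then have "4 dvd (\<Sum>i<n. (coord v i)\<^sup>2 - of_bool (word v i \<noteq> 0))"
    by (rule dvd_sum)
  then have "4 dvd (\<Sum>i<n. (coord v i)\<^sup>2) - int (weight (word v))"
    by (simp only: weight_eq_sum[OF w] sum_subtractf of_nat_sum of_nat_of_bool)
  moreover have "4 dvd int (weight (word v))"
    using C wv by (auto simp: doubly_even_def four_dvd_int)
  ultimately have "4 dvd (\<Sum>i<n. (coord v i)\<^sup>2) - int (weight (word v)) + int (weight (word v))"
    by (rule dvd_add)
  then have "4 dvd (\<Sum>i<n. (coord v i)\<^sup>2)" by (simp only: diff_add_cancel)
  then obtain k where "(\<Sum>i<n. (coord v i)\<^sup>2) = 4 * k" by (rule dvdE)
  then have "(v \<bullet> v) / 2 = of_int k"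
    unfolding inner_self_coord[OF iv] by simp
  then show ?thesis by simp
qed

text \<open>Polarisation of the evenness of the norm.\<close>

lemma code_lattice_integral:
  assumes C: "binary_code n C" "doubly_even C"
    and u: "u \<in> code_lattice \<alpha> C" and v: "v \<in> code_lattice \<alpha> C"
  shows "u \<bullet> v \<in> \<int>"
proof -
  have "u + v \<in> code_lattice \<alpha> C"
    using u v zmod_subspace_code_lattice zmod.subspace_add by blast
  then have "((u + v) \<bullet> (u + v)) / 2 - (u \<bullet> u) / 2 - (v \<bullet> v) / 2 \<in> \<int>"
    using assms by (intro Ints_diff code_lattice_even[OF C])
  also have "((u + v) \<bullet> (u + v)) / 2 - (u \<bullet> u) / 2 - (v \<bullet> v) / 2 = u \<bullet> v"
    by (simp add: inner_add_left inner_add_right inner_commute field_simps)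
  finally show ?thesis .
qed

lemma orthogonal_transformationI:
  fixes f :: "real ^ 'n \<Rightarrow> real ^ 'n"
  assumes "\<And>u v i. i < n \<Longrightarrow> f (u + v) \<bullet> \<alpha> i = f u \<bullet> \<alpha> i + f v \<bullet> \<alpha> i"
    and "\<And>k v i. i < n \<Longrightarrow> f (k *\<^sub>R v) \<bullet> \<alpha> i = k * (f v \<bullet> \<alpha> i)"
    and "\<And>v. (\<Sum>i<n. (f v \<bullet> \<alpha> i)\<^sup>2) = (\<Sum>i<n. (v \<bullet> \<alpha> i)\<^sup>2)"
  shows "orthogonal_transformation f"
  unfolding orthogonal_transformation
proof
  show "linear f"
    by (intro linearI frame_eqI) (simp_all add: assms inner_add_left)
  show "\<forall>v. norm (f v) = norm v"
  proof
    fix v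
    have "f v \<bullet> f v = v \<bullet> v"
      using assms(3)[of v] by (subst (1 2) inner_eq_sum) (simp only: power2_eq_square)
    then show "norm (f v) = norm v" by (simp only: norm_eq_sqrt_inner)
  qed
qed

section \<open>Coordinate permutations as isometries\<close>

definition perm_map :: "(nat \<Rightarrow> nat) \<Rightarrow> real ^ 'n \<Rightarrow> real ^ 'n" where
  "perm_map \<pi> v = vec_of (\<lambda>i. v \<bullet> \<alpha> (\<pi> i))"

lemma inner_perm_map: "i < n \<Longrightarrow> perm_map \<pi> v \<bullet> \<alpha> i = v \<bullet> \<alpha> (\<pi> i)"
  by (simp add: perm_map_def)

context
  fixes \<pi> :: "nat \<Rightarrow> nat"
  assumes \<pi>: "\<pi> permutes {..<n}"
begin

lemma perm_less [simp]: "\<pi> i < n \<longleftrightarrow> i < n"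
  using permutes_in_image[OF \<pi>, of i] by simp

lemma orthogonal_perm_map: "orthogonal_transformation (perm_map \<pi>)"
proof (rule orthogonal_transformationI)
  show "(\<Sum>i<n. (perm_map \<pi> v \<bullet> \<alpha> i)\<^sup>2) = (\<Sum>i<n. (v \<bullet> \<alpha> i)\<^sup>2)" for v
    using sum.permute[OF \<pi>, of "\<lambda>i. (v \<bullet> \<alpha> i)\<^sup>2"] by (simp add: inner_perm_map o_def)
qed (simp_all add: inner_perm_map inner_add_left)

lemma perm_map_inv: "perm_map \<pi> (perm_map (inv \<pi>) v) = v" "perm_map (inv \<pi>) (perm_map \<pi> v) = v"
proof -
  have "inv \<pi> i < n" if "i < n" for i
    using permutes_in_image[OF permutes_inv[OF \<pi>], of i] that by simp
  then show "perm_map \<pi> (perm_map (inv \<pi>) v) = v" "perm_map (inv \<pi>) (perm_map \<pi> v) = v"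
    by (simp_all add: frame_eqI inner_perm_map permutes_inverses[OF \<pi>])
qed

lemma integral_perm_map: "integral_vec v \<Longrightarrow> integral_vec (perm_map \<pi> v)"
  by (auto simp: integral_vec_def inner_perm_map)

lemma coord_perm_map: "coord (perm_map \<pi> v) i = coord v (\<pi> i)"
  by (simp add: coord_def inner_perm_map)

lemma word_perm_map: "word (perm_map \<pi> v) = word v \<circ> \<pi>"
  by (simp add: word_def coord_perm_map fun_eq_iff)

lemma sum_coord_perm_map: "(\<Sum>i<n. coord (perm_map \<pi> v) i) = (\<Sum>i<n. coord v i)"
  using sum.permute[OF \<pi>, of "coord v"] by (simp add: coord_perm_map o_def)

end

lemma code_equiv_permute:
  "\<pi> permutes {..<n} \<Longrightarrow> code_equiv n C ((\<lambda>c. c \<circ> \<pi>) ` C)"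
  by (auto simp: code_equiv_def)

text \<open>One inclusion, assumed for all permutations and codes, suffices: the other inclusion is
  its instance for the inverse permutation.\<close>

lemma perm_map_image_eqI:
  assumes \<pi>: "\<pi> permutes {..<n}" and C: "C' = (\<lambda>c. c \<circ> \<pi>) ` C"
    and "\<And>\<pi> v C. \<pi> permutes {..<n} \<Longrightarrow> v \<in> F C \<Longrightarrow> perm_map \<pi> v \<in> F ((\<lambda>c. c \<circ> \<pi>) ` C)"
  shows "perm_map \<pi> ` F C = F C'"
proof -
  have "(\<lambda>c. c \<circ> inv \<pi>) ` C' = C"
    by (simp add: C image_image comp_assoc permutes_inv_o[OF \<pi>])
  then have "perm_map (inv \<pi>) v \<in> F C" if "v \<in> F C'" for v
    using assms(3)[OF permutes_inv[OF \<pi>] that] by simp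
  then show ?thesis
    using assms perm_map_inv(1)[OF \<pi>] by (metis image_subset_iff subsetI subset_antisym image_eqI)
qed

lemma perm_map_code_lattice:
  assumes \<pi>: "\<pi> permutes {..<n}" and C: "binary_code n C"
  shows "perm_map \<pi> ` code_lattice \<alpha> C = code_lattice \<alpha> ((\<lambda>c. c \<circ> \<pi>) ` C)"
proof -
  let ?F = "\<lambda>C. {v. integral_vec v \<and> word v \<in> C}"
  have "perm_map \<pi> ` ?F C = ?F ((\<lambda>c. c \<circ> \<pi>) ` C)"
    by (rule perm_map_image_eqI[OF \<pi> refl]) (auto simp: integral_perm_map word_perm_map)
  moreover have "binary_code n ((\<lambda>c. c \<circ> \<pi>) ` C)"
    using code_equiv_permute[OF \<pi>] C by (rule binary_code_equiv)
  then have "code_lattice \<alpha> ((\<lambda>c. c \<circ> \<pi>) ` C) = ?F ((\<lambda>c. c \<circ> \<pi>) ` C)"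
    by (auto simp only: mem_code_lattice)
  moreover have "code_lattice \<alpha> C = ?F C"
    using C by (auto simp only: mem_code_lattice)
  ultimately show ?thesis by (simp only:)
qed

lemma perm_map_code_lattice_plus:
  assumes \<pi>: "\<pi> permutes {..<n}" and C: "binary_code n C" "doubly_even C"
  shows "perm_map \<pi> ` code_lattice_plus \<alpha> C = code_lattice_plus \<alpha> ((\<lambda>c. c \<circ> \<pi>) ` C)"
proof -
  let ?F = "\<lambda>C. {v. integral_vec v \<and> word v \<in> C \<and> 4 dvd (\<Sum>i<n. coord v i)}"
  have "perm_map \<pi> ` ?F C = ?F ((\<lambda>c. c \<circ> \<pi>) ` C)"
    by (rule perm_map_image_eqI[OF \<pi> refl])
      (auto simp: integral_perm_map word_perm_map sum_coord_perm_map)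
  moreover have "binary_code n ((\<lambda>c. c \<circ> \<pi>) ` C)" "doubly_even ((\<lambda>c. c \<circ> \<pi>) ` C)"
    using code_equiv_permute[OF \<pi>] C binary_code_equiv doubly_even_equiv by blast+
  then have "code_lattice_plus \<alpha> ((\<lambda>c. c \<circ> \<pi>) ` C) = ?F ((\<lambda>c. c \<circ> \<pi>) ` C)"
    by (auto simp only: mem_code_lattice_plus)
  moreover have "code_lattice_plus \<alpha> C = ?F C"
    using C by (auto simp only: mem_code_lattice_plus)
  ultimately show ?thesis by (simp only:)
qed

lemma lattice_iso_code_lattice:
  assumes "binary_code n C" "code_equiv n C D"
  shows "lattice_iso (code_lattice \<alpha> C) (code_lattice \<alpha> D)"
  using assms perm_map_code_lattice orthogonal_perm_map
  unfolding code_equiv_def lattice_iso_def by metis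

lemma lattice_iso_code_lattice_plus:
  assumes "binary_code n C" "doubly_even C" "code_equiv n C D"
  shows "lattice_iso (code_lattice_plus \<alpha> C) (code_lattice_plus \<alpha> D)"
  using assms perm_map_code_lattice_plus orthogonal_perm_map
  unfolding code_equiv_def lattice_iso_def by metis

section \<open>Moving roots into a frame\<close>

text \<open>For a vector \<open>t\<close> of norm 2 this is the reflection in the hyperplane
  orthogonal to \<open>t\<close>, as the usual factor \<open>2 / (t \<bullet> t)\<close> is then
  1.\<close>

definition reflect :: "real ^ 'n \<Rightarrow> real ^ 'n \<Rightarrow> real ^ 'n" where
  "reflect t v = v - (v \<bullet> t) *\<^sub>R t"

lemma orthogonal_reflect:
  assumes "t \<bullet> t = 2"
  shows "orthogonal_transformation (reflect t)"
  unfolding orthogonal_transformation_def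
proof
  show "linear (reflect t)"
    by (rule linearI) (simp_all add: reflect_def inner_add_left algebra_simps)
  show "\<forall>v w. reflect t v \<bullet> reflect t w = v \<bullet> w"
    using assms by (simp add: reflect_def inner_diff_left inner_diff_right inner_commute)
qed

lemma reflect_reflect:
  assumes "t \<bullet> t = 2" shows "reflect t (reflect t v) = v"
proof -
  have "reflect t v \<bullet> t = - (v \<bullet> t)"
    using assms by (simp add: reflect_def inner_diff_left)
  then have "reflect t (reflect t v) = reflect t v + (v \<bullet> t) *\<^sub>R t"
    by (simp add: reflect_def[of t "reflect t v"])
  then show ?thesis by (simp add: reflect_def)
qed

text \<open>Phrased through values of \<open>f\<close>, so that for a composite
  \<open>f \<circ> h\<close> membership of \<open>v\<close> is membership of \<open>h v\<close> for
  \<open>f\<close>.\<close>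

definition frame_preimage :: "(real ^ 'n \<Rightarrow> real ^ 'n) \<Rightarrow> (real ^ 'n) set" where
  "frame_preimage f = {v. \<exists>i<n. f v = \<alpha> i \<or> f v = - \<alpha> i}"

lemma uminus_frame_preimage: "linear f \<Longrightarrow> v \<in> frame_preimage f \<Longrightarrow> - v \<in> frame_preimage f"
  by (auto simp: frame_preimage_def linear_neg)

lemma frame_preimage_cases:
  assumes f: "orthogonal_transformation f" and "u \<in> frame_preimage f" "v \<in> frame_preimage f"
  shows "u = v \<or> u = - v \<or> u \<bullet> v = 0"
proof -
  have inj: "f x = f y \<longleftrightarrow> x = y" for x y
    using orthogonal_transformation_inj[OF f] by (simp add: inj_eq)
  have uv: "u \<bullet> v = f u \<bullet> f v" using f by (simp add: orthogonal_transformation_def)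
  have neg: "f (- v) = - f v" using f by (simp add: linear_neg orthogonal_transformation_linear)
  obtain i where i: "i < n" "f u = \<alpha> i \<or> f u = - \<alpha> i" using assms(2) by (auto simp: frame_preimage_def)
  obtain j where j: "j < n" "f v = \<alpha> j \<or> f v = - \<alpha> j" using assms(3) by (auto simp: frame_preimage_def)
  show ?thesis
  proof (cases "i = j")
    case True
    then have "f u = f v \<or> f u = f (- v)" using i j neg by auto
    then show ?thesis unfolding inj by blast
  next
    case False
    then show ?thesis using i j by (auto simp: uv inner_frame)
  qed
qed

text \<open>A vector orthogonal to the whole frame is 0, and \<open>f\<close> carries this over to
  the preimages. Their signs are free, so the nonzero product can be made positive.\<close>

lemma frame_preimage_nonorthogonal:
  assumes f: "orthogonal_transformation f" and r: "r \<noteq> 0"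
  obtains v where "v \<in> frame_preimage f" "r \<bullet> v > 0"
proof -
  have "f r \<noteq> 0" using f r by (metis norm_eq_zero orthogonal_transformation)
  then obtain i where i: "i < n" "f r \<bullet> \<alpha> i \<noteq> 0"
    using frame_eqI[of "f r" 0] by auto
  obtain b where b: "f b = \<alpha> i" using orthogonal_transformation_surj[OF f] by (metis surjD)
  then have "b \<in> frame_preimage f" using i by (auto simp: frame_preimage_def)
  moreover then have "- b \<in> frame_preimage f"
    using f uminus_frame_preimage orthogonal_transformation_linear by blast
  moreover have "r \<bullet> b \<noteq> 0" using i b f by (metis orthogonal_transformation_def)
  then have "r \<bullet> b > 0 \<or> r \<bullet> - b > 0" by auto
  ultimately show ?thesis using that by blast
qed

text \<open>The reflection in the root \<open>r - b\<close> exchanges the roots \<open>r\<close> and \<open>b\<close> if \<open>r \<bullet> b = 1\<close>.\<close>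

lemma root_exchange:
  assumes M: "zmod.subspace M" "\<And>u v. u \<in> M \<Longrightarrow> v \<in> M \<Longrightarrow> u \<bullet> v \<in> \<int>"
    and L: "\<And>i. i < n \<Longrightarrow> \<alpha> i \<in> L"
    and f: "orthogonal_transformation f" "f ` M = L"
    and r: "r \<in> M" "r \<bullet> r = 2"
  obtains g where "orthogonal_transformation g" "g ` M = L" "r \<in> frame_preimage g"
    "\<And>s. s \<in> frame_preimage f \<Longrightarrow> s \<bullet> r = 0 \<Longrightarrow> s \<in> frame_preimage g"
proof -
  obtain b where b: "b \<in> frame_preimage f" "r \<bullet> b > 0"
    using frame_preimage_nonorthogonal[OF f(1)] r(2) by (metis inner_zero_left zero_neq_numeral)
  obtain i where i: "i < n" "f b = \<alpha> i \<or> f b = - \<alpha> i" using b by (auto simp: frame_preimage_def)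
  have "b \<bullet> b = f b \<bullet> f b" using f by (simp add: orthogonal_transformation_def)
  then have bb: "b \<bullet> b = 2" using i by (auto simp: inner_frame)
  \<comment> \<open>\<open>f\<close> is injective and maps \<open>M\<close> onto \<open>L\<close>,
    which contains the frame.\<close>
  have bM: "b \<in> M"
  proof -
    obtain b' where b': "b' \<in> M" "f b' = \<alpha> i" using L[OF i(1)] f(2) by auto
    have inj: "f x = f y \<longleftrightarrow> x = y" for x y
      using orthogonal_transformation_inj[OF f(1)] by (simp add: inj_eq)
    have "f (- b') = - f b'" using f by (simp add: linear_neg orthogonal_transformation_linear)
    then have "b = b' \<or> b = - b'" using i b' inj by metis
    then show ?thesis using b' M(1) zmod.subspace_neg by blast
  qed
  show ?thesis
  proof (cases "r = b")
    case True
    then show ?thesis using that f b by blast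
  next
    case False
    let ?t = "r - b"
    obtain k :: int where k: "r \<bullet> b = of_int k" using M(2)[OF r(1) bM] by (auto elim: Ints_cases)
    \<comment> \<open>The norm of \<open>r - b\<close> is \<open>4 - 2 * k\<close>, so
      \<open>k < 2\<close>; as \<open>k\<close> is a positive integer, it is 1.\<close>
    have "0 < ?t \<bullet> ?t" using False by simp
    then have "k = 1"
      using b(2) k r(2) bb by (simp add: inner_diff_left inner_diff_right inner_commute)
    then have rb: "r \<bullet> b = 1" using k by simp
    then have tt: "?t \<bullet> ?t = 2"
      using r bb by (simp add: inner_diff_left inner_diff_right inner_commute)
    have tM: "?t \<in> M" using r bM M(1) zmod.subspace_diff by blast
    let ?g = "f \<circ> reflect ?t"
    have refl_M: "reflect ?t v \<in> M" if v: "v \<in> M" for v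
    proof -
      obtain k :: int where "v \<bullet> ?t = of_int k" using M(2)[OF v tM] by (auto elim: Ints_cases)
      moreover have "of_int k *\<^sub>R ?t \<in> M" for k :: int
        using tM by (rule zmod.subspace_scale[OF M(1)])
      ultimately show ?thesis
        using zmod.subspace_diff[OF M(1) v] by (simp only: reflect_def)
    qed
    show ?thesis
    proof (rule that[of ?g])
      show "orthogonal_transformation ?g"
        by (rule orthogonal_transformation_compose[OF f(1) orthogonal_reflect[OF tt]])
      have "reflect ?t ` M = M"
      proof
        show "reflect ?t ` M \<subseteq> M" using refl_M by blast
        show "M \<subseteq> reflect ?t ` M"
          using refl_M reflect_reflect[OF tt, symmetric] by (intro subsetI) (rule image_eqI)
      qed
      then show "?g ` M = L" using f(2) by (simp only: image_comp[symmetric])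
      have "reflect ?t r = b" using rb r by (simp add: reflect_def inner_diff_right)
      then show "r \<in> frame_preimage ?g" using i by (auto simp: frame_preimage_def)
      show "s \<in> frame_preimage ?g" if s: "s \<in> frame_preimage f" "s \<bullet> r = 0" for s
      proof -
        \<comment> \<open>A frame vector orthogonal to \<open>r\<close> is not \<open>b\<close> or
          \<open>- b\<close>, hence is orthogonal to \<open>b\<close> too and fixed by the
          reflection.\<close>
        have "s \<noteq> b" "s \<noteq> - b" using s(2) b(2) by (auto simp: inner_commute)
        then have "s \<bullet> b = 0" using frame_preimage_cases[OF f(1) s(1) b(1)] by blast
        then have "reflect ?t s = s" using s(2) by (simp add: reflect_def inner_diff_right)
        then show ?thesis using s(1) by (simp add: frame_preimage_def)
      qed
    qed
  qed
qed

text \<open>The roots are brought in one at a time. The exchange for \<open>r\<close> keeps the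
  frame vectors orthogonal to \<open>r\<close>, and an earlier root that is not orthogonal to
  \<open>r\<close> is \<open>r\<close> or \<open>- r\<close>, which the new frame contains.\<close>

lemma roots_into_frame:
  assumes M: "zmod.subspace M" "\<And>u v. u \<in> M \<Longrightarrow> v \<in> M \<Longrightarrow> u \<bullet> v \<in> \<int>"
    and L: "\<And>i. i < n \<Longrightarrow> \<alpha> i \<in> L"
    and f: "orthogonal_transformation f" "f ` M = L"
    and X: "finite X" "X \<subseteq> M" "\<And>x. x \<in> X \<Longrightarrow> x \<bullet> x = 2"
      "\<And>x y. x \<in> X \<Longrightarrow> y \<in> X \<Longrightarrow> x = y \<or> x = - y \<or> x \<bullet> y = 0"
  obtains g where "orthogonal_transformation g" "g ` M = L" "X \<subseteq> frame_preimage g"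
proof -
  have "\<exists>g. orthogonal_transformation g \<and> g ` M = L \<and> X \<subseteq> frame_preimage g"
    using X
  proof (induction X rule: finite_induct)
    case empty
    then show ?case using f by blast
  next
    case (insert r X)
    then obtain g where g: "orthogonal_transformation g" "g ` M = L" "X \<subseteq> frame_preimage g"
      by (metis insertCI insert_subset)
    obtain h where h: "orthogonal_transformation h" "h ` M = L" "r \<in> frame_preimage h"
      "\<And>s. s \<in> frame_preimage g \<Longrightarrow> s \<bullet> r = 0 \<Longrightarrow> s \<in> frame_preimage h"
      using root_exchange[OF M L g(1,2), of r] insert.prems by (metis insertCI insert_subset)
    have "x \<in> frame_preimage h" if "x \<in> X" for x
      using insert.prems(3)[of x r] that g(3) h(3,4)
        uminus_frame_preimage[OF orthogonal_transformation_linear[OF h(1)] h(3)] by auto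
    then show ?case using h by blast
  qed
  then show ?thesis using that by blast
qed

text \<open>A map that permutes the frame up to signs permutes the coordinates up to signs, and
  signs disappear modulo 2.\<close>

lemma code_equiv_of_frame_map:
  assumes C: "binary_code n C" and D: "binary_code n D"
    and g: "orthogonal_transformation g" "g ` code_lattice \<alpha> C = code_lattice \<alpha> D"
    and frame: "\<And>i. i < n \<Longrightarrow> \<alpha> i \<in> frame_preimage g"
  shows "code_equiv n D C"
proof -
  have "\<forall>i. \<exists>j. i < n \<longrightarrow> j < n \<and> (g (\<alpha> i) = \<alpha> j \<or> g (\<alpha> i) = - \<alpha> j)"
    using frame unfolding frame_preimage_def by blast
  then obtain \<tau> where \<tau>: "\<And>i. i < n \<Longrightarrow> \<tau> i < n"
    "\<And>i. i < n \<Longrightarrow> g (\<alpha> i) = \<alpha> (\<tau> i) \<or> g (\<alpha> i) = - \<alpha> (\<tau> i)"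
    by metis
  define \<pi> where "\<pi> i = (if i < n then \<tau> i else i)" for i
  have "inj_on \<tau> {..<n}"
  proof (rule inj_onI, rule ccontr)
    fix i j assume ij: "i \<in> {..<n}" "j \<in> {..<n}" "\<tau> i = \<tau> j" "i \<noteq> j"
    then have "g (\<alpha> i) \<bullet> g (\<alpha> j) \<noteq> 0"
      using \<tau>[of i] \<tau>[of j] by (auto simp: inner_frame)
    moreover have "g (\<alpha> i) \<bullet> g (\<alpha> j) = \<alpha> i \<bullet> \<alpha> j" using g by (simp add: orthogonal_transformation_def)
    ultimately show False using ij by (simp add: inner_frame)
  qed
  moreover from this have "\<tau> ` {..<n} = {..<n}"
    using \<tau>(1) by (intro endo_inj_surj) auto
  ultimately have "bij_betw \<tau> {..<n} {..<n}" by (simp only: bij_betw_def)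
  then have "bij_betw \<pi> {..<n} {..<n}"
    by (rule iffD1[OF bij_betw_cong, rotated]) (simp add: \<pi>_def)
  then have \<pi>: "\<pi> permutes {..<n}"
    by (rule bij_imp_permutes) (simp add: \<pi>_def)
  have inner: "g v \<bullet> \<alpha> (\<pi> i) = v \<bullet> \<alpha> i \<or> g v \<bullet> \<alpha> (\<pi> i) = - (v \<bullet> \<alpha> i)" if "i < n" for v i
  proof -
    have "v \<bullet> \<alpha> i = g v \<bullet> g (\<alpha> i)" using g by (simp add: orthogonal_transformation_def)
    then show ?thesis using \<tau>(2)[OF that] that by (auto simp: \<pi>_def)
  qed
  have word: "word v = word (g v) \<circ> \<pi>" if v: "v \<in> code_lattice \<alpha> C" for v
  proof
    fix i
    have iv: "integral_vec v" "integral_vec (g v)"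
      using v g(2) C D by (auto simp: mem_code_lattice)
    show "word v i = (word (g v) \<circ> \<pi>) i"
    proof (cases "i < n")
      case True
      then have "\<pi> i < n" using \<tau>(1) by (simp add: \<pi>_def)
      then have "real_of_int (coord (g v) (\<pi> i)) = of_int (coord v i) \<or>
          real_of_int (coord (g v) (\<pi> i)) = of_int (- coord v i)"
        using inner[OF True, of v] by (simp add: of_int_coord[OF iv(1) True] of_int_coord[OF iv(2)])
      then have "coord (g v) (\<pi> i) = coord v i \<or> coord (g v) (\<pi> i) = - coord v i"
        unfolding of_int_eq_iff .
      then show ?thesis by (auto simp: word_def)
    next
      case False
      then show ?thesis by (simp add: \<pi>_def)
    qed
  qed
  have "C = (\<lambda>c. c \<circ> \<pi>) ` D"
  proof
    show "C \<subseteq> (\<lambda>c. c \<circ> \<pi>) ` D"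
    proof
      fix c assume c: "c \<in> C"
      then have w: "word (half_vec c) = c" using C by (auto simp: binary_code_def word_half_vec)
      then have h: "half_vec c \<in> code_lattice \<alpha> C" using c C by (simp add: mem_code_lattice)
      then have "word (g (half_vec c)) \<in> D" using g(2) D by (auto simp: mem_code_lattice)
      then show "c \<in> (\<lambda>c. c \<circ> \<pi>) ` D" using word[OF h] w by auto
    qed
    show "(\<lambda>c. c \<circ> \<pi>) ` D \<subseteq> C"
    proof
      fix c assume "c \<in> (\<lambda>c. c \<circ> \<pi>) ` D"
      then obtain d where d: "d \<in> D" "c = d \<circ> \<pi>" by auto
      then have w: "word (half_vec d) = d" using D by (auto simp: binary_code_def word_half_vec)
      then have "half_vec d \<in> code_lattice \<alpha> D" using d D by (simp add: mem_code_lattice)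
      then obtain v where v: "v \<in> code_lattice \<alpha> C" "g v = half_vec d" by (metis g(2) imageE)
      then show "c \<in> C" using word[OF v(1)] w d C by (simp add: mem_code_lattice)
    qed
  qed
  then show ?thesis using \<pi> by (auto simp: code_equiv_def)
qed

section \<open>The isometry of Kleinian blocks\<close>

definition half_block_sum :: "real ^ 'n \<Rightarrow> nat \<Rightarrow> real" where
  "half_block_sum v j = block_sum (\<lambda>i. v \<bullet> \<alpha> i) j / 2"

text \<open>
  On each block of four coordinates, \<open>klein_map\<close> is the symmetric orthogonal matrix
  \<open>1/2\<close> times \<open>(1,-1,-1,1), (-1,1,-1,1), (-1,-1,1,1), (1,1,1,1)\<close>: the last coordinate and
  half the sum of the block are exchanged.
\<close>

definition klein_map :: "real ^ 'n \<Rightarrow> real ^ 'n" where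
  "klein_map v = vec_of (\<lambda>i. if i mod 4 = 3 then half_block_sum v (i div 4)
     else v \<bullet> \<alpha> i + v \<bullet> \<alpha> (4 * (i div 4) + 3) - half_block_sum v (i div 4))"

context
  fixes m :: nat
  assumes m: "n = 4 * m"
begin

lemma lessThan_n: "{..<n} = {..<4 * m}"
  by (simp only: m)

lemma block_less:
  assumes "j < m" shows "4 * j < n" "4 * j + 1 < n" "4 * j + 2 < n" "4 * j + 3 < n"
  using assms by (simp_all add: m)

lemma less_block_cases:
  assumes "i < n"
  obtains j where "j < m" "i = 4 * j" | j where "j < m" "i = 4 * j + 1"
    | j where "j < m" "i = 4 * j + 2" | j where "j < m" "i = 4 * j + 3"
proof (cases i rule: nat_mod4_cases)
  case (1 j) then show ?thesis using assms that(1)[of j] by (simp add: m)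
next
  case (2 j) then show ?thesis using assms that(2)[of j] by (simp add: m)
next
  case (3 j) then show ?thesis using assms that(3)[of j] by (simp add: m)
next
  case (4 j) then show ?thesis using assms that(4)[of j] by (simp add: m)
qed

lemma inner_klein_map:
  assumes j: "j < m"
  shows "klein_map v \<bullet> \<alpha> (4 * j) = v \<bullet> \<alpha> (4 * j) + v \<bullet> \<alpha> (4 * j + 3) - half_block_sum v j"
    "klein_map v \<bullet> \<alpha> (4 * j + 1) = v \<bullet> \<alpha> (4 * j + 1) + v \<bullet> \<alpha> (4 * j + 3) - half_block_sum v j"
    "klein_map v \<bullet> \<alpha> (4 * j + 2) = v \<bullet> \<alpha> (4 * j + 2) + v \<bullet> \<alpha> (4 * j + 3) - half_block_sum v j"
    "klein_map v \<bullet> \<alpha> (4 * j + 3) = half_block_sum v j"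
proof -
  have d: "(4 * j) div 4 = j" "(4 * j + 1) div 4 = j" "(4 * j + 2) div 4 = j" "(4 * j + 3) div 4 = j"
    "(4 * j) mod 4 \<noteq> 3" "(4 * j + 1) mod 4 \<noteq> 3" "(4 * j + 2) mod 4 \<noteq> 3" "(4 * j + 3) mod 4 = 3"
    by presburger+
  show "klein_map v \<bullet> \<alpha> (4 * j) = v \<bullet> \<alpha> (4 * j) + v \<bullet> \<alpha> (4 * j + 3) - half_block_sum v j"
    "klein_map v \<bullet> \<alpha> (4 * j + 1) = v \<bullet> \<alpha> (4 * j + 1) + v \<bullet> \<alpha> (4 * j + 3) - half_block_sum v j"
    "klein_map v \<bullet> \<alpha> (4 * j + 2) = v \<bullet> \<alpha> (4 * j + 2) + v \<bullet> \<alpha> (4 * j + 3) - half_block_sum v j"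
    "klein_map v \<bullet> \<alpha> (4 * j + 3) = half_block_sum v j"
    unfolding klein_map_def
    by (simp_all only: inner_vec_of block_less[OF j] d if_False if_True simp_thms)
qed

lemma half_block_sum_klein_map:
  assumes j: "j < m"
  shows "half_block_sum (klein_map v) j = v \<bullet> \<alpha> (4 * j + 3)"
proof -
  let ?y = "\<lambda>k. v \<bullet> \<alpha> (4 * j + k)" and ?s = "half_block_sum v j"
  have "2 * half_block_sum (klein_map v) j = ((v \<bullet> \<alpha> (4 * j) + ?y 3 - ?s) + (?y 1 + ?y 3 - ?s)) + (?y 2 + ?y 3 - ?s) + ?s"
    unfolding half_block_sum_def[of "klein_map v"] block_sum_def inner_klein_map[OF j] by simp
  also have "\<dots> = (v \<bullet> \<alpha> (4 * j) + ?y 1 + ?y 2 + ?y 3) - 2 * ?s + 2 * ?y 3" by linarith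
  also have "v \<bullet> \<alpha> (4 * j) + ?y 1 + ?y 2 + ?y 3 = 2 * ?s"
    unfolding half_block_sum_def block_sum_def by simp
  finally show ?thesis by linarith
qed

text \<open>In the first three positions of a block the map adds the last coordinate minus half the
  block sum. The second application finds these two numbers exchanged and undoes the shift.\<close>

lemma klein_map_klein_map: "klein_map (klein_map v) = v"
proof (rule frame_eqI)
  fix i assume "i < n"
  then show "klein_map (klein_map v) \<bullet> \<alpha> i = v \<bullet> \<alpha> i"
  proof (cases rule: less_block_cases)
    case (1 j)
    show ?thesis
      unfolding 1(2) inner_klein_map[OF 1(1)] half_block_sum_klein_map[OF 1(1)] by linarith
  next
    case (2 j)
    show ?thesis
      unfolding 2(2) inner_klein_map[OF 2(1)] half_block_sum_klein_map[OF 2(1)] by linarith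
  next
    case (3 j)
    show ?thesis
      unfolding 3(2) inner_klein_map[OF 3(1)] half_block_sum_klein_map[OF 3(1)] by linarith
  next
    case (4 j)
    show ?thesis
      unfolding 4(2) inner_klein_map[OF 4(1)] half_block_sum_klein_map[OF 4(1)] by (rule refl)
  qed
qed

lemma half_block_sum_linear:
  "half_block_sum (u + v) j = half_block_sum u j + half_block_sum v j"
  "half_block_sum (k *\<^sub>R v) j = k * half_block_sum v j"
  unfolding half_block_sum_def block_sum_def by (simp_all add: inner_add_left algebra_simps add_divide_distrib)

lemma orthogonal_klein_map: "orthogonal_transformation klein_map"
proof (rule orthogonal_transformationI)
  fix u v k i assume "i < n"
  then show "klein_map (u + v) \<bullet> \<alpha> i = klein_map u \<bullet> \<alpha> i + klein_map v \<bullet> \<alpha> i"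
    by (simp add: klein_map_def half_block_sum_linear inner_add_left)
next
  fix v k i assume "i < n"
  then show "klein_map (k *\<^sub>R v) \<bullet> \<alpha> i = k * (klein_map v \<bullet> \<alpha> i)"
    by (simp add: klein_map_def half_block_sum_linear right_diff_distrib distrib_left)
next
  fix v
  \<comment> \<open>Since \<open>a + b + c\<close> is \<open>2 * s - d\<close>, everything on the
    left apart from the squares of \<open>a\<close>, \<open>b\<close> and \<open>c\<close> collapses
    to the square of \<open>d\<close>.\<close>
  have sq: "(a + d - s)\<^sup>2 + (b + d - s)\<^sup>2 + (c + d - s)\<^sup>2 + s\<^sup>2 = a\<^sup>2 + b\<^sup>2 + c\<^sup>2 + d\<^sup>2"
    if s: "s = (a + b + c + d) / 2" for a b c d s :: real
    unfolding s by (simp add: power2_eq_square field_simps)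
  show "(\<Sum>i<n. (klein_map v \<bullet> \<alpha> i)\<^sup>2) = (\<Sum>i<n. (v \<bullet> \<alpha> i)\<^sup>2)"
    unfolding lessThan_n sum_blocks4
  proof (rule sum.cong[OF refl])
    fix j assume "j \<in> {..<m}"
    then have j: "j < m" by simp
    show "(klein_map v \<bullet> \<alpha> (4 * j))\<^sup>2 + (klein_map v \<bullet> \<alpha> (4 * j + 1))\<^sup>2 +
        (klein_map v \<bullet> \<alpha> (4 * j + 2))\<^sup>2 + (klein_map v \<bullet> \<alpha> (4 * j + 3))\<^sup>2 =
      (v \<bullet> \<alpha> (4 * j))\<^sup>2 + (v \<bullet> \<alpha> (4 * j + 1))\<^sup>2 + (v \<bullet> \<alpha> (4 * j + 2))\<^sup>2 + (v \<bullet> \<alpha> (4 * j + 3))\<^sup>2"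
      unfolding inner_klein_map[OF j]
      by (rule sq) (simp add: half_block_sum_def block_sum_def)
  qed
qed

lemma klein_map_frame_block:
  assumes "i < n" "l < n" "l div 4 \<noteq> i div 4"
  shows "klein_map (\<alpha> i) \<bullet> \<alpha> l = 0"
proof -
  have z: "\<alpha> i \<bullet> \<alpha> k = 0" if "k < n" "k div 4 = l div 4" for k
    using that assms by (auto simp: inner_frame)
  have "4 * (l div 4) + k < n" "(4 * (l div 4) + k) div 4 = l div 4" if "k < 4" for k
    using assms(2) that m by presburger+
  from z[OF this] have "\<alpha> i \<bullet> \<alpha> (4 * (l div 4) + k) = 0" if "k < 4" for k
    using that by blast
  from this[of 0] this[of 1] this[of 2] this[of 3] z[OF assms(2) refl] show ?thesis
    using assms(2) by (simp add: klein_map_def half_block_sum_def block_sum_def)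
qed

context
  fixes K :: "(nat \<Rightarrow> klein) set" and v :: "real ^ 'n"
  assumes K: "kleinian_code m K" and v: "v \<in> code_lattice \<alpha> (kcode m K)"
begin

lemma binary_code_n_kcode: "binary_code n (kcode m K)"
  using binary_code_kcode[OF K] by (simp only: m)

lemma K_words: "K \<subseteq> words m"
  using K by (simp add: kleinian_code_def)

lemma integral_kcode: "integral_vec v" and word_kcode: "word v \<in> kcode m K"
  using v by (simp_all add: mem_code_lattice[OF binary_code_n_kcode])

text \<open>The parity checks of \<open>kcode m K\<close>, lifted from bits to integers; they make
  the half block sums integral.\<close>

lemma even_block_sum: "2 * (block_sum (coord v) j div 2) = block_sum (coord v) j"
proof -
  have "of_int (block_sum (coord v) j) = block_sum (word v) j"
    by (simp add: block_sum_def word_def)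
  also have "\<dots> = 0" using word_kcode mem_kcode[OF K_words] by blast
  finally show ?thesis by (simp only: of_int_bit_eq_0_iff) (rule dvd_mult_div_cancel)
qed

lemma half_block_sum_coord:
  assumes j: "j < m" shows "half_block_sum v j = of_int (block_sum (coord v) j div 2)"
proof -
  have "2 * half_block_sum v j = of_int (block_sum (coord v) j)"
    by (simp add: half_block_sum_def block_sum_def of_int_coord[OF integral_kcode]
        block_less[OF j] block_less(2,3)[OF j, simplified])
  also have "\<dots> = 2 * of_int (block_sum (coord v) j div 2)"
    by (subst even_block_sum[symmetric]) simp
  finally show ?thesis by simp
qed

lemma integral_klein_map: "integral_vec (klein_map v)"
  unfolding integral_vec_def
proof (intro allI impI)
  fix i assume "i < n"
  moreover have "v \<bullet> \<alpha> k \<in> \<int>" if "k < n" for k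
    using integral_kcode that by (simp add: integral_vec_def)
  ultimately show "klein_map v \<bullet> \<alpha> i \<in> \<int>"
    by (cases rule: less_block_cases)
      (auto simp only: inner_klein_map half_block_sum_coord block_less intro!: Ints_add Ints_diff Ints_of_int)
qed

text \<open>Blocks from \<open>m\<close> on are included, with all coordinates 0, so that words can
  later be compared as functions.\<close>

lemma coord_klein_map:
  fixes j :: nat
  defines "t \<equiv> block_sum (coord v) j div 2"
  shows "coord (klein_map v) (4 * j) = coord v (4 * j) + coord v (4 * j + 3) - t"
    "coord (klein_map v) (4 * j + 1) = coord v (4 * j + 1) + coord v (4 * j + 3) - t"
    "coord (klein_map v) (4 * j + 2) = coord v (4 * j + 2) + coord v (4 * j + 3) - t"
    "coord (klein_map v) (4 * j + 3) = t"
proof -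
  have "real_of_int (coord (klein_map v) (4 * j)) = of_int (coord v (4 * j) + coord v (4 * j + 3) - t) \<and>
    real_of_int (coord (klein_map v) (4 * j + 1)) = of_int (coord v (4 * j + 1) + coord v (4 * j + 3) - t) \<and>
    real_of_int (coord (klein_map v) (4 * j + 2)) = of_int (coord v (4 * j + 2) + coord v (4 * j + 3) - t) \<and>
    real_of_int (coord (klein_map v) (4 * j + 3)) = of_int t"
  proof (cases "j < m")
    case True
    then show ?thesis
      unfolding of_int_add of_int_diff
      by (simp only: of_int_coord[OF integral_klein_map] of_int_coord[OF integral_kcode] block_less
          inner_klein_map half_block_sum_coord t_def)
  next
    case False
    then have "n \<le> 4 * j + k" for k by (simp add: m)
    then have "coord u (4 * j + k) = 0" for k u by (rule coord_ge)
    from this[of _ 0] this[of _ 1] this[of _ 2] this[of _ 3] show ?thesis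
      by (simp add: t_def block_sum_def)
  qed
  then show "coord (klein_map v) (4 * j) = coord v (4 * j) + coord v (4 * j + 3) - t"
    "coord (klein_map v) (4 * j + 1) = coord v (4 * j + 1) + coord v (4 * j + 3) - t"
    "coord (klein_map v) (4 * j + 2) = coord v (4 * j + 2) + coord v (4 * j + 3) - t"
    "coord (klein_map v) (4 * j + 3) = t"
    unfolding of_int_eq_iff by blast+
qed

text \<open>Modulo 2 the map adds the same bit, the last coordinate plus half the block sum, to all
  four positions of a block. Such a change affects neither \<open>block_sum\<close> nor
  \<open>klein_part\<close>.\<close>

lemma word_klein_map_kcode: "word (klein_map v) \<in> kcode m K"
proof -
  let ?t = "\<lambda>j. of_int (block_sum (coord v) j div 2) :: bit"
  have w: "word (klein_map v) (4 * j) = word v (4 * j) + word v (4 * j + 3) + ?t j"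
    "word (klein_map v) (4 * j + 1) = word v (4 * j + 1) + word v (4 * j + 3) + ?t j"
    "word (klein_map v) (4 * j + 2) = word v (4 * j + 2) + word v (4 * j + 3) + ?t j"
    "word (klein_map v) (4 * j + 3) = ?t j" for j
    unfolding word_def coord_klein_map of_int_add of_int_diff minus_bit_def by (rule refl)+
  have "(a + d + t) + (b + d + t) + (c + d + t) + t = a + b + c + d" for a b c d t :: bit
    by (cases d; cases t) (simp_all add: add_ac)
  then have "block_sum (word (klein_map v)) j = block_sum (word v) j" for j
    unfolding block_sum_def w by metis
  moreover have "klein_part (word (klein_map v)) = klein_part (word v)"
    by (rule ext) (simp only: klein_part_def w add.assoc bit_add_self add_0_right)
  moreover have "word (klein_map v) \<in> words (4 * m)"
    unfolding m[symmetric] by (simp add: words_def)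
  ultimately show ?thesis
    using word_kcode unfolding mem_kcode[OF K_words] by simp
qed

text \<open>The last coordinates of the image are the half block sums, which add up to half of the
  coordinate sum of \<open>v\<close>.\<close>

lemma sum_word_klein_map: "(\<Sum>j<m. word (klein_map v) (4 * j + 3)) = 0 \<longleftrightarrow> 4 dvd (\<Sum>i<n. coord v i)"
proof -
  have "(\<Sum>j<m. word (klein_map v) (4 * j + 3)) = of_int (\<Sum>j<m. block_sum (coord v) j div 2)"
    by (simp only: word_def coord_klein_map of_int_sum)
  moreover have "(\<Sum>i<n. coord v i) = 2 * (\<Sum>j<m. block_sum (coord v) j div 2)"
    unfolding lessThan_n sum_blocks4 sum_distrib_left even_block_sum by (simp only: block_sum_def)
  moreover have "4 dvd 2 * k \<longleftrightarrow> even k" for k :: int by presburger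
  ultimately show ?thesis by (simp only: of_int_bit_eq_0_iff)
qed

lemma klein_map_mem: "klein_map v \<in> code_lattice \<alpha> (kcode m K)"
  using integral_klein_map word_klein_map_kcode by (simp add: mem_code_lattice[OF binary_code_n_kcode])

end

text \<open>Both lattices are cut out of the lattice of \<open>kcode m K\<close> by one condition.
  The map preserves that lattice and exchanges the two conditions; being an involution, it also
  supplies the preimages.\<close>

lemma klein_map_image:
  assumes K: "kleinian_code m K" and de: "doubly_even (kcode m K)"
  shows "klein_map ` code_lattice_plus \<alpha> (kcode m K) = code_lattice \<alpha> (kcode_plus m K)"
proof -
  have C: "binary_code n (kcode m K)" "binary_code n (kcode_plus m K)"
    using binary_code_kcode[OF K] binary_code_kcode_plus[OF K] by (simp_all only: m)
  have KW: "K \<subseteq> words m" using K by (simp add: kleinian_code_def)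
  have plus: "v \<in> code_lattice_plus \<alpha> (kcode m K) \<longleftrightarrow>
      v \<in> code_lattice \<alpha> (kcode m K) \<and> 4 dvd (\<Sum>i<n. coord v i)" for v
    using mem_code_lattice_plus[OF C(1) de] mem_code_lattice[OF C(1)] by blast
  have L: "v \<in> code_lattice \<alpha> (kcode_plus m K) \<longleftrightarrow>
      v \<in> code_lattice \<alpha> (kcode m K) \<and> (\<Sum>j<m. word v (4 * j + 3)) = 0" for v
    using mem_code_lattice[OF C(1)] mem_code_lattice[OF C(2)] mem_kcode_plus[OF KW] by blast
  have *: "klein_map v \<in> code_lattice \<alpha> (kcode_plus m K) \<longleftrightarrow> v \<in> code_lattice_plus \<alpha> (kcode m K)"
    if "v \<in> code_lattice \<alpha> (kcode m K)" for v
    using klein_map_mem[OF K that] sum_word_klein_map[OF K that] that unfolding plus L by blast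
  show ?thesis
  proof
    show "klein_map ` code_lattice_plus \<alpha> (kcode m K) \<subseteq> code_lattice \<alpha> (kcode_plus m K)"
      using * plus by blast
    show "code_lattice \<alpha> (kcode_plus m K) \<subseteq> klein_map ` code_lattice_plus \<alpha> (kcode m K)"
    proof
      fix w assume w: "w \<in> code_lattice \<alpha> (kcode_plus m K)"
      then have "klein_map w \<in> code_lattice \<alpha> (kcode m K)" using klein_map_mem[OF K] L by blast
      from *[OF this] have "klein_map w \<in> code_lattice_plus \<alpha> (kcode m K)"
        using w by (simp only: klein_map_klein_map)
      then show "w \<in> klein_map ` code_lattice_plus \<alpha> (kcode m K)"
        using klein_map_klein_map[symmetric] by (rule image_eqI[rotated])
    qed
  qed
qed

lemma lattice_iso_kcode:
  assumes "kleinian_code m K" "doubly_even (kcode m K)"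
  shows "lattice_iso (code_lattice_plus \<alpha> (kcode m K)) (code_lattice \<alpha> (kcode_plus m K))"
  using klein_map_image[OF assms] orthogonal_klein_map unfolding lattice_iso_def by blast

end

section \<open>Roots and tetrads\<close>

definition support :: "real ^ 'n \<Rightarrow> nat set" where
  "support v = {i. coord v i \<noteq> 0}"

lemma support_subset: "support v \<subseteq> {..<n}"
  using coord_ge by (auto simp: support_def not_le[symmetric])

lemma inner_coord:
  "integral_vec u \<Longrightarrow> integral_vec v \<Longrightarrow> u \<bullet> v = of_int (\<Sum>i<n. coord u i * coord v i) / 2"
  by (subst inner_eq_sum) (simp add: of_int_coord)

text \<open>Such a vector is determined by the positions of its entries 1 and -1. This makes the
  system of roots moved into the frame finite.\<close>

lemma finite_unit_coords: "finite {v. integral_vec v \<and> (\<forall>i. coord v i \<in> {-1, 0, 1})}"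
proof (rule finite_subset)
  let ?h = "\<lambda>(A, B). vec_of (\<lambda>i. of_bool (i \<in> A) - of_bool (i \<in> B))"
  show "finite (?h ` (Pow {..<n} \<times> Pow {..<n}))" by simp
  show "{v. integral_vec v \<and> (\<forall>i. coord v i \<in> {-1, 0, 1})} \<subseteq> ?h ` (Pow {..<n} \<times> Pow {..<n})"
  proof
    fix v assume "v \<in> {v. integral_vec v \<and> (\<forall>i. coord v i \<in> {-1, 0, 1})}"
    then have v: "integral_vec v" "\<And>i. coord v i \<in> {-1, 0, 1}" by auto
    let ?A = "{i\<in>{..<n}. coord v i = 1}" and ?B = "{i\<in>{..<n}. coord v i = -1}"
    have "v = ?h (?A, ?B)"
    proof (rule frame_eqI)
      fix i assume i: "i < n"
      have "v \<bullet> \<alpha> i = of_int (coord v i)" using of_int_coord[OF v(1) i] by simp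
      then show "v \<bullet> \<alpha> i = ?h (?A, ?B) \<bullet> \<alpha> i" using v(2)[of i] i by auto
    qed
    moreover have "(?A, ?B) \<in> Pow {..<n} \<times> Pow {..<n}" by auto
    ultimately show "v \<in> ?h ` (Pow {..<n} \<times> Pow {..<n})" by (rule image_eqI)
  qed
qed

definition indicator_word :: "nat set \<Rightarrow> nat \<Rightarrow> bit" where
  "indicator_word T = (\<lambda>i. of_bool (i \<in> T))"

lemma indicator_words: "T \<subseteq> {..<n} \<Longrightarrow> indicator_word T \<in> words n"
  by (auto simp: indicator_word_def words_def)

lemma coord_half_indicator: "T \<subseteq> {..<n} \<Longrightarrow> coord (half_vec (indicator_word T)) i = of_bool (i \<in> T)"
  by (cases "i < n") (auto simp: coord_half_vec indicator_word_def)

lemma orthogonal_disjoint_support: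
  assumes "integral_vec u" "integral_vec v" "support u \<inter> support v = {}"
  shows "u \<bullet> v = 0"
proof -
  have "coord u i * coord v i = 0" for i
    using assms(3) by (auto simp: support_def)
  then show ?thesis unfolding inner_coord[OF assms(1,2)] by (simp only: sum.neutral_const of_int_0 div_0)
qed

lemma support_half_indicator: "T \<subseteq> {..<n} \<Longrightarrow> support (half_vec (indicator_word T)) = T"
  by (simp add: support_def coord_half_indicator)

context
  fixes C :: "(nat \<Rightarrow> bit) set"
  assumes C: "binary_code n C" "doubly_even C"
begin

definition plus_roots :: "(real ^ 'n) set" where
  "plus_roots = {v \<in> code_lattice_plus \<alpha> C. v \<bullet> v = 2}"

definition tetrads :: "nat set set" where
  "tetrads = {T. T \<subseteq> {..<n} \<and> card T = 4 \<and> indicator_word T \<in> C}"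

lemma plus_roots_lattice:
  assumes "v \<in> plus_roots"
  shows "integral_vec v" "word v \<in> C" "4 dvd (\<Sum>i<n. coord v i)" "(\<Sum>i<n. (coord v i)\<^sup>2) = 4"
proof -
  show iv: "integral_vec v" and "word v \<in> C" "4 dvd (\<Sum>i<n. coord v i)"
    using assms C by (simp_all add: plus_roots_def mem_code_lattice_plus)
  have "real_of_int (\<Sum>i<n. (coord v i)\<^sup>2) = of_int 4"
    using inner_self_coord[OF iv] assms by (simp add: plus_roots_def)
  then show "(\<Sum>i<n. (coord v i)\<^sup>2) = 4" unfolding of_int_eq_iff .
qed

text \<open>
  A vector of norm 2 is either \<open>\<plusminus>\<alpha> i\<close>, which the condition on the coordinate sum
  excludes, or has four coordinates \<open>\<plusminus>1\<close>.
\<close>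

lemma plus_roots_coord:
  assumes v: "v \<in> plus_roots"
  shows "coord v i \<in> {-1, 0, 1}"
proof (rule ccontr)
  assume c: "coord v i \<notin> {-1, 0, 1}"
  then have i: "i < n" using coord_ge[of i v] by (cases "i < n") auto
  have "2 \<le> \<bar>coord v i\<bar>" using c by auto
  then have "2\<^sup>2 \<le> \<bar>coord v i\<bar>\<^sup>2" by (intro power_mono) auto
  then have ge: "4 \<le> (coord v i)\<^sup>2" by simp
  have s: "(\<Sum>k<n. (coord v k)\<^sup>2) = (coord v i)\<^sup>2 + (\<Sum>k\<in>{..<n} - {i}. (coord v k)\<^sup>2)"
    using i by (intro sum.remove) auto
  moreover have pos: "0 \<le> (\<Sum>k\<in>{..<n} - {i}. (coord v k)\<^sup>2)" by (intro sum_nonneg) simp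
  \<comment> \<open>The square of this coordinate uses up the total of 4. All others vanish, so the
    coordinate itself is the coordinate sum and is divisible by 4, while its square is 4.\<close>
  ultimately have e: "(coord v i)\<^sup>2 = 4" "(\<Sum>k\<in>{..<n} - {i}. (coord v k)\<^sup>2) = 0"
    using plus_roots_lattice(4)[OF v] ge by linarith+
  then have "\<forall>k\<in>{..<n} - {i}. coord v k = 0"
    by (subst (asm) sum_nonneg_eq_0_iff) auto
  then have "(\<Sum>k\<in>{..<n} - {i}. coord v k) = 0" by (intro sum.neutral) auto
  moreover have "(\<Sum>k<n. coord v k) = coord v i + (\<Sum>k\<in>{..<n} - {i}. coord v k)"
    using i by (intro sum.remove) auto
  ultimately have "4 dvd coord v i" using plus_roots_lattice(3)[OF v] by simp
  then obtain k where k: "coord v i = 4 * k" by (rule dvdE)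
  have "16 * k\<^sup>2 = 4" using e(1) unfolding k by (simp add: power2_eq_square)
  then show False by presburger
qed

lemma word_plus_roots:
  assumes v: "v \<in> plus_roots" shows "word v = indicator_word (support v)"
proof
  show "word v i = indicator_word (support v) i" for i
    using plus_roots_coord[OF v, of i] by (auto simp: word_def indicator_word_def support_def)
qed

lemma support_plus_roots:
  assumes v: "v \<in> plus_roots" shows "support v \<in> tetrads"
proof -
  have "(coord v i)\<^sup>2 = of_bool (coord v i \<noteq> 0)" for i
    using plus_roots_coord[OF v, of i] by auto
  then have "(\<Sum>i<n. of_bool (coord v i \<noteq> 0)) = (4::int)"
    using plus_roots_lattice(4)[OF v] by simp
  moreover have "{..<n} \<inter> {i. coord v i \<noteq> 0} = support v"
    using support_subset[of v] by (auto simp: support_def)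
  ultimately have "card (support v) = 4" by simp
  then show ?thesis
    using support_subset plus_roots_lattice(2)[OF v] word_plus_roots[OF v] by (simp add: tetrads_def)
qed

text \<open>Let \<open>e\<close> be the indicator of the common support. The coordinates of
  \<open>e - x\<close> and \<open>e - y\<close> are even, so the sum of their products is divisible
  by 4; expanding it shows that \<open>x \<bullet> y\<close> is an even integer. For vectors of norm
  2 it is then 2, -2 or 0, and the extreme values force \<open>x = y\<close> or
  \<open>x = - y\<close>.\<close>

lemma plus_roots_same_support:
  assumes x: "x \<in> plus_roots" and y: "y \<in> plus_roots" and supp: "support x = support y"
  shows "x = y \<or> x = - y \<or> x \<bullet> y = 0"
proof -
  let ?e = "\<lambda>i. of_bool (i \<in> support x) :: int" and ?S = "\<Sum>i<n. coord x i * coord y i"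
  have sx: "i \<in> support x \<longleftrightarrow> coord x i \<noteq> 0" for i by (simp add: support_def)
  have sy: "i \<in> support x \<longleftrightarrow> coord y i \<noteq> 0" for i unfolding supp by (simp add: support_def)
  have cx: "coord x i = 0 \<and> ?e i = 0 \<or> odd (coord x i) \<and> ?e i = 1" for i
    unfolding sx using plus_roots_coord[OF x, of i] by auto
  have cy: "coord y i = 0 \<and> ?e i = 0 \<or> odd (coord y i) \<and> ?e i = 1" for i
    unfolding sy using plus_roots_coord[OF y, of i] by auto
  have "2 * 2 dvd (?e i - coord x i) * (?e i - coord y i)" for i
    using cx[of i] cy[of i] by (intro mult_dvd_mono) auto
  then have d4: "4 dvd (\<Sum>i<n. (?e i - coord x i) * (?e i - coord y i))"
    by (intro dvd_sum) simp
  have e4: "(\<Sum>i<n. ?e i) = 4"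
  proof -
    have "{..<n} \<inter> support x = support x" using support_subset by blast
    then show ?thesis using support_plus_roots[OF x] by (simp add: tetrads_def)
  qed
  \<comment> \<open>On the support \<open>e\<close> is 1, and off it all three entries are
    0.\<close>
  have "(?e i - coord x i) * (?e i - coord y i) = ?e i - coord x i - coord y i + coord x i * coord y i" for i
    using cx[of i] cy[of i] by (auto simp: algebra_simps)
  then have eq: "(\<Sum>i<n. (?e i - coord x i) * (?e i - coord y i)) =
      4 - (\<Sum>i<n. coord x i) - (\<Sum>i<n. coord y i) + ?S"
    by (simp only: sum.distrib sum_subtractf e4)
  have "4 dvd 4 - (\<Sum>i<n. coord x i) - (\<Sum>i<n. coord y i)"
    by (intro dvd_diff plus_roots_lattice(3)[OF x] plus_roots_lattice(3)[OF y] dvd_refl)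
  then have "4 dvd ?S"
    using d4 unfolding eq by (simp only: dvd_add_right_iff)
  then obtain k where k: "?S = 4 * k" by (rule dvdE)
  have xy: "x \<bullet> y = 2 * of_int k"
    unfolding inner_coord[OF plus_roots_lattice(1)[OF x] plus_roots_lattice(1)[OF y]] k by simp
  have xx: "x \<bullet> x = 2" "y \<bullet> y = 2" using x y by (auto simp: plus_roots_def)
  have d: "(x - y) \<bullet> (x - y) = 4 - 4 * of_int k" "(x + y) \<bullet> (x + y) = 4 + 4 * of_int k"
    using xx xy by (simp_all add: inner_diff_left inner_diff_right inner_add_left inner_add_right inner_commute)
  have "0 \<le> (x - y) \<bullet> (x - y)" "0 \<le> (x + y) \<bullet> (x + y)" by simp_all
  then have "k \<in> {-1, 0, 1}" unfolding d by auto
  moreover have "x = y" if "k = 1" using d(1) that by simp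
  moreover have "x = - y" if "k = -1" using d(2) that by (simp add: eq_neg_iff_add_eq_0)
  ultimately show ?thesis using xy by auto
qed

lemma half_indicator_plus_roots:
  assumes T: "T \<in> tetrads"
  shows "half_vec (indicator_word T) \<in> plus_roots"
proof -
  have T': "T \<subseteq> {..<n}" "card T = 4" "indicator_word T \<in> C" using T by (auto simp: tetrads_def)
  have "{..<n} \<inter> T = T" using T'(1) by blast
  then have s: "(\<Sum>i<n. of_bool (i \<in> T)) = (4::int)" using T'(2) by simp
  then have "(\<Sum>i<n. coord (half_vec (indicator_word T)) i) = 4"
    by (simp only: coord_half_indicator[OF T'(1)])
  moreover have "(\<Sum>i<n. (coord (half_vec (indicator_word T)) i)\<^sup>2) = 4"
    using s by (simp only: coord_half_indicator[OF T'(1)] power2_eq_square of_bool_conj[symmetric] conj_absorb)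
  ultimately show ?thesis
    using T' C indicator_words[OF T'(1)] inner_self_coord[OF integral_half_vec[of "indicator_word T"]]
    by (simp add: plus_roots_def mem_code_lattice_plus word_half_vec)
qed

text \<open>Subtracting \<open>\<alpha> a\<close>, whose coordinate at \<open>a\<close> is 2, turns
  the entry 1 into -1. Two such changes lower the coordinate sum by 4, which keeps the vector in the
  plus lattice.\<close>

lemma flip_two_signs:
  assumes T: "T \<in> tetrads" and ab: "a \<in> T" "b \<in> T" "a \<noteq> b"
  defines "v \<equiv> half_vec (indicator_word T) - (\<alpha> a + \<alpha> b)"
  shows "v \<in> plus_roots" "support v = T"
proof -
  let ?h = "half_vec (indicator_word T)"
  have T': "T \<subseteq> {..<n}" using T by (simp add: tetrads_def)
  then have lt: "a < n" "b < n" using ab by auto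
  have h: "?h \<in> code_lattice_plus \<alpha> C" "?h \<bullet> ?h = 2"
    using half_indicator_plus_roots[OF T] by (auto simp: plus_roots_def)
  have "\<alpha> a + \<alpha> b \<in> code_lattice_plus \<alpha> C"
    using C lt binary_codeD(1)[OF C(1)]
    by (simp add: mem_code_lattice_plus word_add coord_add coord_frame sum.distrib)
  then have "v \<in> code_lattice_plus \<alpha> C"
    unfolding v_def using h(1) zmod.subspace_diff zmod_subspace_code_lattice_plus by blast
  moreover have "?h \<bullet> \<alpha> a = 1" "?h \<bullet> \<alpha> b = 1"
    using lt ab by (simp_all add: inner_half_vec indicator_word_def)
  then have "v \<bullet> v = 2"
    using h(2) lt ab(3)
    by (simp add: v_def inner_diff_left inner_diff_right inner_add_left inner_add_right inner_frame inner_commute)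
  ultimately show "v \<in> plus_roots" by (simp add: plus_roots_def)
  have "coord v i = of_bool (i \<in> T) - ((if a = i then 2 else 0) + (if b = i then 2 else 0))" for i
    using lt by (simp add: v_def coord_diff coord_add coord_frame coord_half_indicator[OF T'])
  then show "support v = T" using ab by (auto simp: support_def)
qed

end

section \<open>Doubly even codes containing all block words\<close>

lemma inner_half_vec_half_vec:
  "half_vec c \<bullet> half_vec d = (\<Sum>i<n. of_bool (c i = 1 \<and> d i = 1)) / 2"
proof -
  have "(\<Sum>i<n. (half_vec c \<bullet> \<alpha> i) * (half_vec d \<bullet> \<alpha> i)) = (\<Sum>i<n. of_bool (c i = 1 \<and> d i = 1))"
    by (intro sum.cong) (auto simp: inner_half_vec)
  then show ?thesis by (subst inner_eq_sum) (simp only:)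
qed

text \<open>The inner product of the two half vectors is half the size of the common support, and
  the lattice is integral.\<close>

lemma doubly_even_self_orthogonal:
  assumes C: "binary_code n C" "doubly_even C" and cd: "c \<in> C" "d \<in> C"
  shows "even (\<Sum>i<n. of_bool (c i = 1 \<and> d i = 1) :: nat)"
proof -
  have "half_vec c \<in> code_lattice \<alpha> C" if "c \<in> C" for c
    using that C(1) word_half_vec[of c] by (auto simp: mem_code_lattice binary_code_def)
  then have "half_vec c \<bullet> half_vec d \<in> \<int>"
    using cd code_lattice_integral[OF C] by blast
  then obtain k where "half_vec c \<bullet> half_vec d = of_int k" by (rule Ints_cases)
  then have "real_of_int (int (\<Sum>i<n. of_bool (c i = 1 \<and> d i = 1))) = of_int (2 * k)"
    unfolding inner_half_vec_half_vec by simp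
  then have "int (\<Sum>i<n. of_bool (c i = 1 \<and> d i = 1)) = 2 * k"
    unfolding of_int_eq_iff .
  then have "even (int (\<Sum>i<n. of_bool (c i = 1 \<and> d i = 1)))" by (simp only: dvd_triv_left)
  then show ?thesis unfolding even_of_nat .
qed

text \<open>The block words generate \<open>d4 m\<close> inside \<open>C\<close>, and orthogonality
  to them makes every codeword even on each block. So \<open>C\<close> is a union of classes modulo
  \<open>d4 m\<close>, and \<open>K\<close> collects the Kleinian words whose encoding lies in
  \<open>C\<close>.\<close>

lemma kcode_of_blocks:
  assumes m: "n = 4 * m" and C: "binary_code n C" "doubly_even C"
    and blocks: "\<And>j. j < m \<Longrightarrow> indicator_word {4 * j..<4 * j + 4} \<in> C"
  obtains K where "kleinian_code m K" "even_kleinian K" "C = kcode m K"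
proof -
  let ?K = "{x \<in> words m. hat x \<in> C}"
  have C0: "0 \<in> C" and Cadd: "\<And>c d. c \<in> C \<Longrightarrow> d \<in> C \<Longrightarrow> c + d \<in> C"
    using binary_codeD[OF C(1)] by blast+
  have CW: "C \<subseteq> words (4 * m)" using C(1) by (simp add: binary_code_def m)
  have bs: "block_sum c j = 0" if c: "c \<in> C" for c j
  proof (cases "j < m")
    case True
    let ?B = "{4 * j..<4 * j + 4}"
    have "(\<Sum>i<n. of_bool (c i = 1 \<and> indicator_word ?B i = 1)) = (\<Sum>i\<in>?B. of_bool (c i = 1) :: nat)"
      by (rule sum.mono_neutral_cong_right)
        (use True in \<open>auto simp: m indicator_word_def\<close>)
    then have "even (\<Sum>i\<in>?B. of_bool (c i = 1) :: nat)"
      using doubly_even_self_orthogonal[OF C c blocks[OF True]] by (simp only:)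
    then show ?thesis
      unfolding block_sum_def sum_block4
      by (cases "c (4 * j)"; cases "c (4 * j + 1)"; cases "c (4 * j + 2)"; cases "c (4 * j + 3)") simp_all
  next
    case False
    then show ?thesis using c CW unfolding block_sum_def words_blocks4_iff subset_iff
      by (metis add_0_left linorder_not_less)
  qed
  have d4C: "d \<in> C" if d: "d \<in> d4 m" for d
  proof -
    \<comment> \<open>Adding block words one by one yields the indicator of any set of
      blocks.\<close>
    have J: "(\<lambda>i. of_bool (i div 4 \<in> J)) \<in> C" if "finite J" "J \<subseteq> {..<m}" for J
      using that
    proof (induction J rule: finite_induct)
      case empty
      then show ?case using C0 by (simp add: zero_fun_def)
    next
      case (insert j J)
      have "i \<in> {4 * j..<4 * j + 4} \<longleftrightarrow> i div 4 = j" for i by auto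
      then have "indicator_word {4 * j..<4 * j + 4} + (\<lambda>i. of_bool (i div 4 \<in> J)) =
          (\<lambda>i. of_bool (i div 4 \<in> insert j J))"
        using insert.hyps(2) by (auto simp: fun_eq_iff indicator_word_def)
      then show ?case using Cadd[OF blocks[of j] insert.IH] insert.prems by simp
    qed
    have "d = (\<lambda>i. of_bool (i div 4 \<in> {j. j < m \<and> d (4 * j + 3) = 1}))"
    proof
      fix i
      have e: "d (4 * j) = d (4 * j + 3)" "d (4 * j + 1) = d (4 * j + 3)" "d (4 * j + 2) = d (4 * j + 3)" for j
        using d unfolding d4_iff by blast+
      have "d i = d (4 * (i div 4) + 3)"
      proof (cases i rule: nat_mod4_cases)
        case (1 j)
        have "i div 4 = j" using 1 by simp
        then show ?thesis using e(1)[of j] 1 by metis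
      next
        case (2 j)
        have "i div 4 = j" using 2 by simp
        then show ?thesis using e(2)[of j] 2 by metis
      next
        case (3 j)
        have "i div 4 = j" using 3 by simp
        then show ?thesis using e(3)[of j] 3 by metis
      next
        case (4 j)
        have "i div 4 = j" using 4 by simp
        then show ?thesis using 4 by metis
      qed
      moreover have "d (4 * (i div 4) + 3) = 0" if "\<not> i div 4 < m"
        using d that unfolding d4_iff words_blocks4_iff by simp
      ultimately show "d i = of_bool (i div 4 \<in> {j. j < m \<and> d (4 * j + 3) = 1})"
        by (cases "i div 4 < m"; cases "d (4 * (i div 4) + 3)") simp_all
    qed
    moreover have "(\<lambda>i. of_bool (i div 4 \<in> {j. j < m \<and> d (4 * j + 3) = 1})) \<in> C"
      by (rule J) auto
    ultimately show ?thesis by (simp only:)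
  qed
  have "kleinian_code m ?K"
    unfolding kleinian_code_def
  proof (intro conjI ballI)
    show "0 \<in> ?K" using C0 by (simp add: words_def)
    show "x + y \<in> ?K" if "x \<in> ?K" "y \<in> ?K" for x y
      using that Cadd by (simp add: words_def hat_add)
    have "- x = x" for x :: "nat \<Rightarrow> klein" by (simp add: fun_eq_iff prod_eq_iff)
    then show "- x \<in> ?K" if "x \<in> ?K" for x using that by simp
  qed auto
  moreover have "even_kleinian ?K"
    unfolding even_kleinian_def
  proof
    fix x assume "x \<in> ?K"
    then have "4 dvd 2 * weight x" using C(2) weight_hat[of x m] by (auto simp: doubly_even_def)
    moreover have "4 dvd 2 * k \<Longrightarrow> even k" for k :: nat by presburger
    ultimately show "even (weight x)" by blast
  qed
  moreover have "C = kcode m ?K"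
  proof
    show "kcode m ?K \<subseteq> C"
      using Cadd d4C by (auto simp: kcode_def set_plus_def)
    show "C \<subseteq> kcode m ?K"
    proof
      fix c assume c: "c \<in> C"
      then have cw: "c \<in> words (4 * m)" using CW by blast
      let ?h = "hat (klein_part c)"
      have "c + ?h \<in> d4 m" using hat_klein_part_diff(1)[OF cw bs[OF c]] .
      then have "c + (c + ?h) \<in> C" using c d4C Cadd by blast
      moreover have "c + (c + ?h) = ?h" by (simp add: fun_eq_iff)
      ultimately have "klein_part c \<in> ?K" using klein_part_words[OF cw] by simp
      then show "c \<in> kcode m ?K"
        using cw bs[OF c] mem_kcode[of ?K m c] by blast
    qed
  qed
  ultimately show ?thesis using that by blast
qed

section \<open>The partition of the coordinates into tetrads\<close>

lemma tetrad_partition: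
  assumes C: "binary_code n C" "doubly_even C" and D: "binary_code n D"
    and f: "orthogonal_transformation f" "f ` code_lattice_plus \<alpha> C = code_lattice \<alpha> D"
  obtains P g where "P \<subseteq> tetrads C" "pairwise disjnt P" "\<Union>P = {..<n}"
    "orthogonal_transformation g" "g ` code_lattice_plus \<alpha> C = code_lattice \<alpha> D"
    "{v \<in> plus_roots C. support v \<in> P} \<subseteq> frame_preimage g"
proof -
  let ?M = "code_lattice_plus \<alpha> C"
  have "tetrads C \<subseteq> Pow {..<n}" unfolding tetrads_def[OF C] by blast
  then have "finite (tetrads C)" by (rule finite_subset) simp
  then obtain P where P: "P \<subseteq> tetrads C" "pairwise disjnt P"
    and max: "\<And>T. T \<in> tetrads C \<Longrightarrow> (\<And>S. S \<in> P \<Longrightarrow> disjnt T S) \<Longrightarrow> T \<in> P"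
    by (rule obtain_maximal_disjoint) blast
  let ?X = "{v \<in> plus_roots C. support v \<in> P}"
  have roots: "plus_roots C \<subseteq> ?M" "v \<in> plus_roots C \<Longrightarrow> v \<bullet> v = 2" for v
    by (auto simp: plus_roots_def[OF C])
  have "?X \<subseteq> {v. integral_vec v \<and> (\<forall>i. coord v i \<in> {-1, 0, 1})}"
    using plus_roots_lattice(1)[OF C] plus_roots_coord[OF C] by blast
  then have Xfin: "finite ?X" using finite_unit_coords by (rule finite_subset)
  have Xort: "x = y \<or> x = - y \<or> x \<bullet> y = 0" if "x \<in> ?X" "y \<in> ?X" for x y
  proof (cases "support x = support y")
    case True
    then show ?thesis using that plus_roots_same_support[OF C] by blast
  next
    case False
    then have "support x \<inter> support y = {}"
      using that P(2) unfolding pairwise_def disjnt_def by blast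
    then show ?thesis
      using that orthogonal_disjoint_support plus_roots_lattice(1)[OF C] by blast
  qed
  have Mint: "u \<bullet> v \<in> \<int>" if "u \<in> ?M" "v \<in> ?M" for u v
    using that code_lattice_plus_subset[OF C] code_lattice_integral[OF C] by blast
  have XM: "?X \<subseteq> ?M" using roots(1) by blast
  have X2: "x \<bullet> x = 2" if "x \<in> ?X" for x using roots(2) that by blast
  obtain g where g: "orthogonal_transformation g" "g ` ?M = code_lattice \<alpha> D"
    "?X \<subseteq> frame_preimage g"
    by (rule roots_into_frame[OF zmod_subspace_code_lattice_plus Mint frame_mem_code_lattice[OF D]
          f Xfin XM X2 Xort])
  have "k \<in> \<Union>P" if k: "k < n" for k
  proof (rule ccontr)
    assume kP: "k \<notin> \<Union>P"
    have "\<alpha> k \<noteq> 0" using inner_frame[OF k k] by auto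
    \<comment> \<open>A frame root not orthogonal to \<open>\<alpha> k\<close> has \<open>k\<close>
      in its support, so this support is a tetrad outside \<open>P\<close>.\<close>
    then obtain b where b: "b \<in> frame_preimage g" "\<alpha> k \<bullet> b > 0"
      using frame_preimage_nonorthogonal[OF g(1)] by blast
    then obtain i where i: "i < n" "g b = \<alpha> i \<or> g b = - \<alpha> i" by (auto simp: frame_preimage_def)
    have "g b \<in> code_lattice \<alpha> D"
      using i frame_mem_code_lattice[OF D i(1)] zmod.subspace_neg[OF zmod_subspace_code_lattice] by metis
    then obtain b' where "b' \<in> ?M" "g b = g b'" using g(2) by (metis imageE)
    then have bM: "b \<in> ?M" using orthogonal_transformation_inj[OF g(1)] by (metis injD)
    have "b \<bullet> b = g b \<bullet> g b" using g(1) by (simp add: orthogonal_transformation_def)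
    then have "b \<bullet> b = 2" using i by (auto simp: inner_frame)
    then have br: "b \<in> plus_roots C" using bM by (simp add: plus_roots_def[OF C])
    note ib = plus_roots_lattice(1)[OF C br]
    have inner_b: "b \<bullet> \<alpha> l = of_int (coord b l)" if "l < n" for l
      using of_int_coord[OF ib that] by simp
    have ks: "k \<in> support b"
      using b(2) inner_b[OF k] by (auto simp: support_def inner_commute)
    have disj: "disjnt (support b) T" if T: "T \<in> P" for T
    proof (rule ccontr)
      assume "\<not> disjnt (support b) T"
      then obtain a where a: "a \<in> support b" "a \<in> T" by (auto simp: disjnt_def)
      have tT: "T \<in> tetrads C" using T P(1) by blast
      then have Tn: "T \<subseteq> {..<n}" and cT: "card T = 4" by (auto simp: tetrads_def[OF C])
      \<comment> \<open>The support of \<open>b\<close> contains \<open>k\<close> and that of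
        \<open>x\<close> does not, so these two members of the frame differ even up to sign.\<close>
      have ortho: "b \<bullet> x = 0" if "x \<in> plus_roots C" "support x = T" for x
      proof -
        have "support b \<noteq> support x" using ks kP T that(2) by blast
        moreover have "support (- x) = support x"
          using coord_scale[of x "-1"] plus_roots_lattice(1)[OF C that(1)] by (simp add: support_def)
        ultimately have "b \<noteq> x" "b \<noteq> - x" by auto
        moreover have "x \<in> frame_preimage g" using g(3) that T by blast
        ultimately show ?thesis using frame_preimage_cases[OF g(1) b(1)] by blast
      qed
      \<comment> \<open>Two roots on \<open>T\<close> that differ by
        \<open>\<alpha> c + \<alpha> d\<close> are both orthogonal to \<open>b\<close>.\<close>
      have opp: "coord b c + coord b d = 0" if cd: "c \<in> T" "d \<in> T" "c \<noteq> d" for c d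
      proof -
        have "b \<bullet> half_vec (indicator_word T) = 0"
          using half_indicator_plus_roots[OF C tT] support_half_indicator[OF Tn] by (rule ortho)
        moreover have "b \<bullet> (half_vec (indicator_word T) - (\<alpha> c + \<alpha> d)) = 0"
          using flip_two_signs[OF C tT cd] by (rule ortho)
        ultimately have "b \<bullet> \<alpha> c + b \<bullet> \<alpha> d = 0" by (simp add: inner_diff_right inner_add_right)
        moreover have "c < n" "d < n" using cd Tn by auto
        ultimately have "real_of_int (coord b c + coord b d) = of_int 0"
          by (simp add: inner_b)
        then show ?thesis unfolding of_int_eq_iff .
      qed
      \<comment> \<open>Three positions with pairwise opposite entries carry only zeros.\<close>
      have "card (T - {a}) = 3" using a cT by simp
      then obtain c d where cd: "c \<in> T - {a}" "d \<in> T - {a}" "c \<noteq> d"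
        by (auto simp: card_3_iff)
      then have "coord b a = 0" using opp[of a c] opp[of a d] opp[of c d] a(2) by auto
      then show False using a(1) by (simp add: support_def)
    qed
    have "support b \<in> P" using support_plus_roots[OF C br] disj by (rule max)
    then show False using ks kP by blast
  qed
  moreover have "\<Union>P \<subseteq> {..<n}" using P(1) unfolding tetrads_def[OF C] by blast
  ultimately have "\<Union>P = {..<n}" by blast
  then show ?thesis using that P(1,2) g by blast
qed

section \<open>The two directions of the equivalence\<close>

lemma iso_of_kleinian_code:
  assumes C: "binary_code n C" "doubly_even C" and D: "binary_code n D"
    and m: "4 * m = n" and K: "kleinian_code m K"
    and equiv: "code_equiv n C (kcode m K)" "code_equiv n D (kcode_plus m K)"
  shows "lattice_iso (code_lattice_plus \<alpha> C) (code_lattice \<alpha> D)"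
proof -
  have "lattice_iso (code_lattice_plus \<alpha> C) (code_lattice_plus \<alpha> (kcode m K))"
    using C equiv(1) by (rule lattice_iso_code_lattice_plus)
  moreover have "lattice_iso (code_lattice_plus \<alpha> (kcode m K)) (code_lattice \<alpha> (kcode_plus m K))"
    using lattice_iso_kcode[OF m[symmetric] K doubly_even_equiv[OF equiv(1) C(2)]] .
  moreover have "lattice_iso (code_lattice \<alpha> D) (code_lattice \<alpha> (kcode_plus m K))"
    using D equiv(2) by (rule lattice_iso_code_lattice)
  then have "lattice_iso (code_lattice \<alpha> (kcode_plus m K)) (code_lattice \<alpha> D)"
    by (rule lattice_iso_sym)
  ultimately show ?thesis by (blast intro: lattice_iso_trans)
qed

text \<open>Rearranging by \<open>\<pi>\<close> turns the tetrads of \<open>P\<close> into blocks,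
  which yields \<open>K\<close>. Following \<open>klein_map\<close> by the inverse rearrangement and
  \<open>g\<close> maps the lattice of \<open>kcode_plus m K\<close> onto that of \<open>D\<close>;
  it remains to see that this composite permutes the frame up to signs.\<close>

lemma kleinian_code_of_iso:
  assumes C: "binary_code n C" "doubly_even C" and D: "binary_code n D"
    and iso: "lattice_iso (code_lattice_plus \<alpha> C) (code_lattice \<alpha> D)"
  obtains m K where "4 * m = n" "kleinian_code m K" "even_kleinian K"
    "code_equiv n C (kcode m K)" "code_equiv n D (kcode_plus m K)"
proof -
  obtain f where f: "orthogonal_transformation f" "f ` code_lattice_plus \<alpha> C = code_lattice \<alpha> D"
    using iso by (auto simp: lattice_iso_def)
  obtain P g where P: "P \<subseteq> tetrads C" "pairwise disjnt P" "\<Union>P = {..<n}"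
    and g: "orthogonal_transformation g" "g ` code_lattice_plus \<alpha> C = code_lattice \<alpha> D"
    and frame: "{v \<in> plus_roots C. support v \<in> P} \<subseteq> frame_preimage g"
    by (rule tetrad_partition[OF C D f])
  have card_P: "card T = 4" if "T \<in> P" for T
    using that P(1) unfolding tetrads_def[OF C] by blast
  obtain m \<pi> where m: "n = 4 * m" and \<pi>: "\<pi> permutes {..<n}"
    and blocks': "\<forall>j<m. \<pi> ` {4 * j..<4 * j + 4} \<in> P"
    by (rule partition_into_quadruples[OF P(3,2) card_P])
  have blocks: "\<pi> ` {4 * j..<4 * j + 4} \<in> P" if "j < m" for j
    using blocks' that by blast
  let ?C' = "(\<lambda>c. c \<circ> \<pi>) ` C"
  have equiv: "code_equiv n C ?C'" using \<pi> by (rule code_equiv_permute)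
  have C': "binary_code n ?C'" "doubly_even ?C'"
    using binary_code_equiv[OF equiv C(1)] doubly_even_equiv[OF equiv C(2)] .
  have "indicator_word {4 * j..<4 * j + 4} \<in> ?C'" if j: "j < m" for j
  proof (rule image_eqI)
    show "indicator_word (\<pi> ` {4 * j..<4 * j + 4}) \<in> C"
      using blocks[OF j] P(1) unfolding tetrads_def[OF C] by blast
    show "indicator_word {4 * j..<4 * j + 4} = indicator_word (\<pi> ` {4 * j..<4 * j + 4}) \<circ> \<pi>"
      using inj_image_mem_iff[OF permutes_inj[OF \<pi>]] by (simp add: indicator_word_def fun_eq_iff)
  qed
  then obtain K where K: "kleinian_code m K" "even_kleinian K" "?C' = kcode m K"
    by (rule kcode_of_blocks[OF m C'])
  let ?E = "kcode_plus m K"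
  have E: "binary_code n ?E" using binary_code_kcode_plus[OF K(1)] by (simp only: m)
  note kC = klein_map_image[OF m K(1) C'(2)[unfolded K(3)], folded K(3)]
  have \<pi>': "inv \<pi> permutes {..<n}" using \<pi> by (rule permutes_inv)
  have "klein_map ` code_lattice \<alpha> ?E = code_lattice_plus \<alpha> ?C'"
    unfolding kC[symmetric] image_image klein_map_klein_map[OF m] by (rule image_ident)
  moreover have "perm_map (inv \<pi>) ` code_lattice_plus \<alpha> ?C' = code_lattice_plus \<alpha> C"
    unfolding perm_map_code_lattice_plus[OF \<pi> C, symmetric] image_image perm_map_inv(2)[OF \<pi>]
    by (rule image_ident)
  ultimately have pk: "(perm_map (inv \<pi>) \<circ> klein_map) ` code_lattice \<alpha> ?E = code_lattice_plus \<alpha> C"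
    by (simp only: image_comp[symmetric])
  let ?p = "perm_map (inv \<pi>) \<circ> klein_map"
  have orth_p: "orthogonal_transformation ?p"
    by (rule orthogonal_transformation_compose[OF orthogonal_perm_map[OF \<pi>'] orthogonal_klein_map[OF m]])
  have "\<alpha> i \<in> frame_preimage (g \<circ> ?p)" if i: "i < n" for i
  proof -
    let ?T = "\<pi> ` {4 * (i div 4)..<4 * (i div 4) + 4}"
    have TP: "?T \<in> P" using blocks[of "i div 4"] i m by simp
    have "?p (\<alpha> i) \<in> code_lattice_plus \<alpha> C"
      using pk frame_mem_code_lattice[OF E i] by blast
    moreover have "?p (\<alpha> i) \<bullet> ?p (\<alpha> i) = \<alpha> i \<bullet> \<alpha> i"
      using orth_p unfolding orthogonal_transformation_def by blast
    ultimately have root: "?p (\<alpha> i) \<in> plus_roots C"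
      using i by (simp add: plus_roots_def[OF C] inner_frame)
    have "support (?p (\<alpha> i)) \<subseteq> ?T"
    proof
      fix l assume l: "l \<in> support (?p (\<alpha> i))"
      then have ln: "l < n" using support_subset by blast
      then have l': "inv \<pi> l < n" using perm_less[OF \<pi>'] by blast
      have "?p (\<alpha> i) \<bullet> \<alpha> l \<noteq> 0" using l ln by (auto simp: support_def coord_def)
      then have "klein_map (\<alpha> i) \<bullet> \<alpha> (inv \<pi> l) \<noteq> 0" using ln by (simp add: inner_perm_map)
      then have "inv \<pi> l div 4 = i div 4" using klein_map_frame_block[OF m i l'] by blast
      then have "inv \<pi> l \<in> {4 * (i div 4)..<4 * (i div 4) + 4}" by auto
      then show "l \<in> ?T"
        using permutes_inverses(1)[OF \<pi>, of l, symmetric] by (rule image_eqI[rotated])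
    qed
    moreover have "finite ?T" by simp
    \<comment> \<open>The image of a frame vector is a root inside one rearranged block. Both sets
      have four elements, so the support is this member of \<open>P\<close>, and the root is one of
      those that \<open>g\<close> sends into the frame.\<close>
    moreover have "card ?T = card (support (?p (\<alpha> i)))"
      using card_P[OF TP] support_plus_roots[OF C root] unfolding tetrads_def[OF C] by simp
    ultimately have "support (?p (\<alpha> i)) = ?T" using card_subset_eq by metis
    then have "?p (\<alpha> i) \<in> frame_preimage g" using frame root TP by auto
    then show ?thesis by (simp add: frame_preimage_def)
  qed
  moreover have "orthogonal_transformation (g \<circ> ?p)"
    using g(1) orth_p by (rule orthogonal_transformation_compose)
  moreover have "(g \<circ> ?p) ` code_lattice \<alpha> ?E = code_lattice \<alpha> D"
    using pk g(2) by (simp only: image_comp[of g ?p, symmetric])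
  ultimately have "code_equiv n D ?E"
    using code_equiv_of_frame_map[OF E D] by blast
  then show ?thesis using that m K equiv by metis
qed

end

theorem theorem2p8:
  fixes n :: nat
    and C D :: "(nat \<Rightarrow> bit) set"
    and \<alpha> :: "nat \<Rightarrow> real ^ 'n"
  assumes n: "n = CARD('n)"
    and basis: "norm2_orthogonal_basis \<alpha>"
    and C: "binary_code n C" "doubly_even C"
    and D: "binary_code n D" "doubly_even D"
  shows "lattice_iso (code_lattice_plus \<alpha> C) (code_lattice \<alpha> D) \<longleftrightarrow>
    (\<exists>m K. 4 * m = n \<and> kleinian_code m K \<and> even_kleinian K \<and>
       code_equiv n C (kcode m K) \<and> code_equiv n D (kcode_plus m K))"
proof -
  interpret norm2_frame n \<alpha> using n basis by unfold_locales
  show ?thesis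
    using iso_of_kleinian_code[OF C D(1)] kleinian_code_of_iso[OF C D(1)] by metis
qed

end
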